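(* Let $p\ge 1$, let $\boldsymbol{\mu}\in\mathbb{R}^{p+1}$ and $\boldsymbol{\Lambda}\in\mathbb{R}^{(p+1)\times(p+1)}$ be given, and let $\mathbb{P}^G_{\mathbf{X},Y}$ be the (jointly) Gaussian probability distribution of $(\mathbf{X},Y)$, $\mathbf{X}=(X_1,\dots,X_p)$, with first moment $\mathbb{E}[(\mathbf{X}\;\;Y)]=\boldsymbol{\mu}$ and second moment $\mathbb{E}[(\mathbf{X}\;\;Y)^T(\mathbf{X}\;\;Y)]=\boldsymbol{\Lambda}$. Then $\mathbb{P}^G_{\mathbf{X},Y}$ is a minimizer of the problem $$\min_{\mathbb{P}_{\mathbf{X},Y}} \rho_m(\mathbf{X},Y)\quad\text{s.t.}\quad \mathbb{E}_{\mathbb{P}}[(\mathbf{X}\;\;Y)]=\boldsymbol{\mu},\ \ \mathbb{E}_{\mathbb{P}}[(\mathbf{X}\;\;Y)^T(\mathbf{X}\;\;Y)]=\boldsymbol{\Lambda},$$ where the minimum is over all joint probability distributions of $(\mathbf{X},Y)$ on $\mathbb{R}^p\times\mathbb{R}$ with these first and second order moments.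
   Context: Here $(\mathbf{X}\;\;Y)$ denotes the row vector in $\mathbb{R}^{1\times(p+1)}$, so $\boldsymbol{\Lambda}$ is the matrix of second moments. For random variables $\mathbf{X}$ (possibly vector-valued) and $Y$ with joint law $\mathbb{P}$, the Hirschfeld–Gebelein–Rényi (HGR) maximal correlation is $\rho_m(\mathbf{X},Y)=\sup_{f,g}\mathbb{E}_{\mathbb{P}}[f(\mathbf{X})g(Y)]$, the supremum taken over all measurable $f,g$ with $\mathbb{E}[f(\mathbf{X})]=\mathbb{E}[g(Y)]=0$ and $\mathbb{E}[f^2(\mathbf{X})]=\mathbb{E}[g^2(Y)]=1$. *)

theory Defs
  imports "HOL-Probability.Probability"
begin

definition joint_vec :: "(real^'p) \<times> real \<Rightarrow> real^('p option)" where
  "joint_vec z = (\<chi> j. case j of None \<Rightarrow> snd z | Some i \<Rightarrow> fst z $ i)"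

definition is_law :: "((real^'p) \<times> real) measure \<Rightarrow> bool" where
  "is_law M \<longleftrightarrow> prob_space M \<and> sets M = sets borel"

definition has_moments ::
  "((real^'p) \<times> real) measure \<Rightarrow> real^('p option) \<Rightarrow> real^('p option)^('p option) \<Rightarrow> bool" where
  "has_moments M \<mu> \<Lambda> \<longleftrightarrow>
     (\<forall>j. integrable M (\<lambda>z. joint_vec z $ j) \<and> (\<integral>z. joint_vec z $ j \<partial>M) = \<mu> $ j) \<and>
     (\<forall>j k. integrable M (\<lambda>z. joint_vec z $ j * joint_vec z $ k) \<and>
            (\<integral>z. joint_vec z $ j * joint_vec z $ k \<partial>M) = \<Lambda> $ j $ k)"

definition gaussian_law :: "((real^'p) \<times> real) measure \<Rightarrow> bool" where
  "gaussian_law M \<longleftrightarrow> is_law M \<and>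
     (\<forall>a b. \<exists>m \<sigma>. \<sigma> \<ge> 0 \<and>
        distr M lborel (\<lambda>z. a \<bullet> fst z + b * snd z) =
          (if \<sigma> = 0 then return lborel m else density lborel (normal_density m \<sigma>)))"

text \<open>HGR maximal correlation (as an extended real; the supremum of the
  empty set is -infinity in the degenerate case where no admissible f,g exist).\<close>
definition hgr :: "((real^'p) \<times> real) measure \<Rightarrow> ereal" where
  "hgr M = (SUP fg \<in> {(f :: real^'p \<Rightarrow> real, g :: real \<Rightarrow> real).
       f \<in> borel_measurable borel \<and> g \<in> borel_measurable borel \<and>
       integrable M (\<lambda>z. f (fst z)) \<and> integrable M (\<lambda>z. g (snd z)) \<and>
       integrable M (\<lambda>z. (f (fst z))\<^sup>2) \<and> integrable M (\<lambda>z. (g (snd z))\<^sup>2) \<and>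
       (\<integral>z. f (fst z) \<partial>M) = 0 \<and> (\<integral>z. g (snd z) \<partial>M) = 0 \<and>
       (\<integral>z. (f (fst z))\<^sup>2 \<partial>M) = 1 \<and> (\<integral>z. (g (snd z))\<^sup>2 \<partial>M) = 1}.
     ereal (\<integral>z. fst fg (fst z) * snd fg (snd z) \<partial>M))"

end

theory Submission
  imports Defs
begin

text \<open>Let \<open>\<kappa> (t \<bullet> X)\<close> be the best linear prediction of \<open>Y\<close> from \<open>X\<close>, and \<open>R\<close> the correlation of
  \<open>t \<bullet> X\<close> and \<open>Y\<close>. Both depend on the first two moments only, and affine \<open>f\<close>, \<open>g\<close> show that the maximal
  correlation of every law with these moments is at least \<open>R\<close>. For the Gaussian law, the residual
  \<open>W = Y - \<kappa> (t \<bullet> X)\<close> is independent of \<open>X\<close>, so after standardization the conditional expectation of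
  \<open>g(Y)\<close> given \<open>X\<close> is the Mehler operator \<open>T g (u) = E g (R u + sqrt (1 - R\<^sup>2) Z)\<close>, evaluated at the
  standardized \<open>t \<bullet> X\<close>; it remains to see that \<open>T\<close> contracts centered functions by the factor \<open>R\<close>.
  For bounded \<open>g\<close>, \<open>T g\<close> is Lipschitz, and each further application of \<open>T\<close> multiplies the
  Lipschitz constant by \<open>R\<close>; hence the norms of \<open>T ^ n g\<close> are \<open>O(R ^ n)\<close>. As \<open>T\<close> is self-adjoint, these norms
  are log-convex in \<open>n\<close>, so that already the first ratio is at most \<open>R\<close>. Truncation gives the
  general case. Degenerate Gaussian laws have no admissible pair \<open>f\<close>, \<open>g\<close>.\<close>

subsection \<open>The Mehler operator\<close>

lemma integral_mult_Cauchy_Schwarz: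
  fixes f g :: "'a \<Rightarrow> real"
  assumes [measurable]: "f \<in> borel_measurable M" "g \<in> borel_measurable M"
    and f2: "integrable M (\<lambda>x. (f x)\<^sup>2)" and g2: "integrable M (\<lambda>x. (g x)\<^sup>2)"
  shows integrable_mult_of_square_integrable: "integrable M (\<lambda>x. f x * g x)"
    and "(\<integral>x. f x * g x \<partial>M)\<^sup>2 \<le> (\<integral>x. (f x)\<^sup>2 \<partial>M) * (\<integral>x. (g x)\<^sup>2 \<partial>M)"
proof -
  have young: "\<bar>a * b\<bar> \<le> a\<^sup>2 + b\<^sup>2" for a b :: real
    using zero_le_power2[of "\<bar>a\<bar> - \<bar>b\<bar>"] by (simp add: power2_diff abs_mult)
      (use zero_le_power2[of a] zero_le_power2[of b] in linarith)
  show fg: "integrable M (\<lambda>x. f x * g x)"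
    by (rule Bochner_Integration.integrable_bound[OF Bochner_Integration.integrable_add[OF f2 g2]])
      (use young in auto)
  define A where "A = (\<integral>x. (f x)\<^sup>2 \<partial>M)"
  define B where "B = (\<integral>x. f x * g x \<partial>M)"
  define C where "C = (\<integral>x. (g x)\<^sup>2 \<partial>M)"
  \<comment> \<open>Discriminant argument: the second moment of \<open>f + t g\<close> is a
    quadratic in \<open>t\<close> without negative values.\<close>
  have quad: "0 \<le> A + 2 * t * B + t\<^sup>2 * C" for t
  proof -
    have "0 \<le> (\<integral>x. (f x + t * g x)\<^sup>2 \<partial>M)" by simp
    also have "(\<lambda>x. (f x + t * g x)\<^sup>2) = (\<lambda>x. (f x)\<^sup>2 + (2 * t) * (f x * g x) + t\<^sup>2 * (g x)\<^sup>2)"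
      by (simp add: fun_eq_iff power2_sum power_mult_distrib)
    also have "(\<integral>x. (f x)\<^sup>2 + (2 * t) * (f x * g x) + t\<^sup>2 * (g x)\<^sup>2 \<partial>M) = A + 2 * t * B + t\<^sup>2 * C"
      using f2 g2 fg by (simp add: A_def B_def C_def)
    finally show ?thesis .
  qed
  have "B\<^sup>2 \<le> A * C"
  proof (cases "C = 0")
    case True
    have "B = 0"
    proof (rule ccontr)
      assume "B \<noteq> 0"
      \<comment> \<open>With \<open>C = 0\<close> the quadratic is affine in \<open>t\<close>; at
        this \<open>t\<close> its value is \<open>-1\<close>.\<close>
      then show False using quad[of "- (A + 1) / (2 * B)"] True by (simp add: field_simps)
    qed
    then show ?thesis using True by simp
  next
    case False
    then have "C > 0" by (simp add: C_def order.not_eq_order_implies_strict)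
    \<comment> \<open>The minimizer of the quadratic.\<close>
    with quad[of "- B / C"] show ?thesis
      by (simp add: power2_eq_square field_simps)
  qed
  then show "(\<integral>x. f x * g x \<partial>M)\<^sup>2 \<le> (\<integral>x. (f x)\<^sup>2 \<partial>M) * (\<integral>x. (g x)\<^sup>2 \<partial>M)"
    by (simp add: A_def B_def C_def)
qed

text \<open>Log-convexity makes the ratios of successive terms increase, so the exponential growth rate
  bounds already the first ratio.\<close>
lemma log_convex_first_ratio_le:
  fixes b :: "nat \<Rightarrow> real"
  assumes nonneg: "\<And>n. 0 \<le> b n" and conv: "\<And>n. (b (Suc n))\<^sup>2 \<le> b n * b (Suc (Suc n))"
    and bound: "\<And>n. b n \<le> C * q ^ n" and "0 < q"
  shows "b 1 \<le> q * b 0"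
proof (rule ccontr)
  assume *: "\<not> b 1 \<le> q * b 0"
  have "b 0 \<noteq> 0" using conv[of 0] * by auto
  then have b0: "b 0 > 0" using nonneg[of 0] by simp
  define t where "t = b 1 / b 0"
  have t: "t > q" using * b0 by (simp add: t_def field_simps)
  \<comment> \<open>Positivity is carried along because the induction step cancels the factor
    \<open>b n\<close>.\<close>
  have step: "b n > 0 \<and> b (Suc n) \<ge> t * b n" for n
  proof (induction n)
    case 0 then show ?case using b0 by (simp add: t_def)
  next
    case (Suc n)
    then have n: "b n > 0" "t * b n \<le> b (Suc n)" by auto
    then have Sn: "b (Suc n) > 0" using t \<open>0 < q\<close>
      by (meson less_le_trans less_trans mult_pos_pos)
    have "(t * b n) * b (Suc n) \<le> b (Suc n) * b (Suc n)" using n Sn by simp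
    also have "\<dots> \<le> b n * b (Suc (Suc n))" using conv[of n] by (simp add: power2_eq_square)
    finally have "b n * (t * b (Suc n)) \<le> b n * b (Suc (Suc n))" by (simp add: ac_simps)
    then show ?case using n Sn by simp
  qed
  have lower: "t ^ n * b 0 \<le> b n" for n
  proof (induction n)
    case (Suc n)
    then have "t * (t ^ n * b 0) \<le> t * b n" using t \<open>0 < q\<close> by (intro mult_left_mono) auto
    then show ?case using step[of n] by (simp add: ac_simps)
  qed simp
  have le: "(t / q) ^ n \<le> C / b 0" for n
    using order.trans[OF lower[of n] bound[of n]] \<open>0 < q\<close> b0
    by (simp add: power_divide field_simps)
  have "t / q > 1" using t \<open>0 < q\<close> by simp
  then obtain n where "C / b 0 < (t / q) ^ n" using real_arch_pow by blast
  then show False using le[of n] by simp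
qed

section \<open>Mehler operator: kernel, symmetry, smoothing, contraction\<close>

lemma integrable_std_normal_bounded:
  fixes g :: "real \<Rightarrow> real"
  assumes "g \<in> borel_measurable borel" "\<And>x. \<bar>g x\<bar> \<le> K"
  shows "integrable std_normal_distribution g"
proof -
  interpret real_distribution std_normal_distribution by (rule real_dist_normal_dist)
  show ?thesis by (rule integrable_const_bound[of _ K]) (use assms in auto)
qed

text \<open>For \<open>0 < R < 1\<close> this is Mehler's formula for the Ornstein-Uhlenbeck
  semigroup at time \<open>- ln R\<close>.\<close>

definition mehler :: "real \<Rightarrow> (real \<Rightarrow> real) \<Rightarrow> real \<Rightarrow> real" where
  "mehler R g x = (\<integral>z. g (R * x + sqrt (1 - R\<^sup>2) * z) \<partial>std_normal_distribution)"

lemma sqrt_one_minus_square_pos: "0 \<le> R \<Longrightarrow> R < 1 \<Longrightarrow> 0 < sqrt (1 - R\<^sup>2)" for R :: real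
  by (simp add: power_less_one_iff abs_square_less_1)

lemma mehler_measurable [measurable]:
  assumes [measurable]: "g \<in> borel_measurable borel"
  shows "mehler R g \<in> borel_measurable borel"
proof -
  interpret real_distribution std_normal_distribution by (rule real_dist_normal_dist)
  show ?thesis unfolding mehler_def by measurable
qed

lemma mehler_bounded:
  assumes "g \<in> borel_measurable borel" "\<And>x. \<bar>g x\<bar> \<le> K"
  shows "\<bar>mehler R g x\<bar> \<le> K"
proof -
  interpret real_distribution std_normal_distribution by (rule real_dist_normal_dist)
  note [measurable] = assms(1)
  have "\<bar>mehler R g x\<bar> \<le> (\<integral>z. \<bar>g (R * x + sqrt (1 - R\<^sup>2) * z)\<bar> \<partial>std_normal_distribution)"
    unfolding mehler_def by (rule integral_abs_bound)
  also have "\<dots> \<le> (\<integral>z. K \<partial>std_normal_distribution)"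
    by (intro integral_mono integrable_std_normal_bounded[of _ K])
      (use assms order.trans[OF abs_ge_zero assms(2)[of 0]] in auto)
  finally show ?thesis using prob_space by simp
qed

text \<open>Substituting \<open>y = R * x + sqrt (1 - R\<^sup>2) * z\<close> moves \<open>x\<close>
  from the argument of \<open>g\<close> into a transition density. Both the symmetry of the operator
  and its smoothing effect are read off from this form.\<close>

lemma mehler_eq_normal_density:
  assumes [measurable]: "g \<in> borel_measurable borel" and "0 \<le> R" "R < 1"
  shows "mehler R g x = (\<integral>y. normal_density (R * x) (sqrt (1 - R\<^sup>2)) y * g y \<partial>lborel)"
proof -
  define r where "r = sqrt (1 - R\<^sup>2)"
  have r: "r > 0" unfolding r_def by (rule sqrt_one_minus_square_pos) (use assms in auto)
  have "(\<integral>y. normal_density (R * x) r y * g y \<partial>lborel)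
      = r * (\<integral>z. normal_density (R * x) r (R * x + r * z) * g (R * x + r * z) \<partial>lborel)"
    using lborel_integral_real_affine[of r "\<lambda>y. normal_density (R * x) r y * g y" "R * x"] r by simp
  also have "\<dots> = (\<integral>z. r * (normal_density (R * x) r (R * x + r * z) * g (R * x + r * z)) \<partial>lborel)"
    by simp
  also have "\<dots> = (\<integral>z. std_normal_density z * g (R * x + r * z) \<partial>lborel)"
    using r by (intro Bochner_Integration.integral_cong)
      (auto simp: normal_density_def real_sqrt_mult power_mult_distrib)
  also have "\<dots> = mehler R g x"
    unfolding mehler_def r_def by (subst integral_density) auto
  finally show ?thesis by (simp add: r_def)
qed

text \<open>The joint density of a standard Gaussian pair with correlation \<open>R\<close> is symmetric.\<close>
lemma mehler_selfadjoint:
  assumes g: "g \<in> borel_measurable borel" "\<And>x. \<bar>g x\<bar> \<le> K"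
    and h: "h \<in> borel_measurable borel" "\<And>x. \<bar>h x\<bar> \<le> K'" and R: "0 \<le> R" "R < 1"
  shows "(\<integral>x. h x * mehler R g x \<partial>std_normal_distribution)
    = (\<integral>x. mehler R h x * g x \<partial>std_normal_distribution)"
proof -
  define r where "r = sqrt (1 - R\<^sup>2)"
  have r: "r > 0" unfolding r_def by (rule sqrt_one_minus_square_pos) (use R in auto)
  have r2: "r\<^sup>2 = 1 - R\<^sup>2" using R by (simp add: r_def power_le_one)
  \<comment> \<open>The joint density of the pair: first marginal times transition density.\<close>
  define k where "k x y = std_normal_density x * normal_density (R * x) r y" for x y
  note [measurable] = g(1) h(1)
  have kmeas [measurable]: "case_prod k \<in> borel_measurable (lborel \<Otimes>\<^sub>M lborel)"
    unfolding k_def normal_density_def split_beta' by measurable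
  have k_nonneg: "k x y \<ge> 0" for x y by (simp add: k_def)
  have k_sym: "k x y = k y x" for x y
  proof -
    have "k x y = 1 / sqrt (2 * pi) * (1 / sqrt (2 * pi * r\<^sup>2)) * exp (- (x\<^sup>2 - 2 * R * x * y + y\<^sup>2) / (2 * r\<^sup>2))" for x y
    proof -
      \<comment> \<open>Since \<open>r\<^sup>2 + R\<^sup>2 = 1\<close>, the Gaussian factor in
        \<open>x\<close> cancels the asymmetric part of the square, leaving a form symmetric in
        \<open>x\<close> and \<open>y\<close>.\<close>
      have sq: "(y - R * x)\<^sup>2 = (x\<^sup>2 - 2 * R * x * y + y\<^sup>2) - r\<^sup>2 * x\<^sup>2"
        by (simp add: r2 power2_diff power_mult_distrib algebra_simps)
      have cancel: "- a / 2 + - (q - r\<^sup>2 * a) / (2 * r\<^sup>2) = - q / (2 * r\<^sup>2)" for a q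
        using r by (simp add: field_simps)
      have "k x y = 1 / sqrt (2 * pi) * (1 / sqrt (2 * pi * r\<^sup>2)) * (exp (- x\<^sup>2 / 2) * exp (- (y - R * x)\<^sup>2 / (2 * r\<^sup>2)))"
        by (simp add: k_def normal_density_def)
      then show ?thesis unfolding sq exp_add[symmetric] cancel .
    qed
    then show ?thesis by (simp add: algebra_simps)
  qed
  have k_int: "integrable (lborel \<Otimes>\<^sub>M lborel) (case_prod k)"
    by (rule lborel_pair.Fubini_integrable[OF kmeas]) (use r k_nonneg in \<open>auto simp: k_def\<close>)
  have int: "integrable (lborel \<Otimes>\<^sub>M lborel) (\<lambda>(x, y). k x y * (h x * g y))"
  proof (rule Bochner_Integration.integrable_bound[of _ "\<lambda>p. (K' * K) * case_prod k p"])
    have "\<bar>k x y * (h x * g y)\<bar> \<le> \<bar>K' * K * k x y\<bar>" for x y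
    proof -
      have "\<bar>h x\<bar> * \<bar>g y\<bar> \<le> K' * K"
        by (rule mult_mono[OF h(2) g(2)]) (use h(2)[of x] in auto)
      then have "k x y * (\<bar>h x\<bar> * \<bar>g y\<bar>) \<le> k x y * (K' * K)" by (rule mult_left_mono) (rule k_nonneg)
      also have "\<dots> \<le> \<bar>K' * K * k x y\<bar>" by (simp add: ac_simps)
      finally show ?thesis using k_nonneg by (simp add: abs_mult)
    qed
    then show "AE p in lborel \<Otimes>\<^sub>M lborel. norm (case p of (x, y) \<Rightarrow> k x y * (h x * g y))
        \<le> norm (K' * K * case_prod k p)" by auto
    show "integrable (lborel \<Otimes>\<^sub>M lborel) (\<lambda>p. (K' * K) * case_prod k p)" using k_int by simp
    show "(\<lambda>(x, y). k x y * (h x * g y)) \<in> borel_measurable (lborel \<Otimes>\<^sub>M lborel)"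
      using kmeas by measurable
  qed
  have dens: "(\<integral>x. u x \<partial>std_normal_distribution) = (\<integral>x. std_normal_density x * u x \<partial>lborel)"
    if "u \<in> borel_measurable borel" for u :: "real \<Rightarrow> real"
    using that by (subst integral_density) auto
  have "(\<integral>x. h x * mehler R g x \<partial>std_normal_distribution)
    = (\<integral>x. std_normal_density x * (h x * (\<integral>y. normal_density (R * x) r y * g y \<partial>lborel)) \<partial>lborel)"
    unfolding dens[OF borel_measurable_times[OF h(1) mehler_measurable[OF g(1)]]]
    by (simp only: mehler_eq_normal_density[OF g(1) R] r_def)
  also have "\<dots> = (\<integral>x. (\<integral>y. k x y * (h x * g y) \<partial>lborel) \<partial>lborel)"
    by (simp add: k_def ac_simps flip: integral_mult_right_zero)
  also have "\<dots> = (\<integral>y. (\<integral>x. k x y * (h x * g y) \<partial>lborel) \<partial>lborel)"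
    by (rule lborel_pair.Fubini_integral[symmetric]) (use int in simp)
  also have "\<dots> = (\<integral>y. (\<integral>x. k y x * (h x * g y) \<partial>lborel) \<partial>lborel)"
    by (subst k_sym) simp
  also have "\<dots> = (\<integral>x. std_normal_density x * ((\<integral>y. normal_density (R * x) r y * h y \<partial>lborel) * g x) \<partial>lborel)"
    by (simp add: k_def ac_simps flip: integral_mult_right_zero)
  also have "\<dots> = (\<integral>x. mehler R h x * g x \<partial>std_normal_distribution)"
    unfolding dens[OF borel_measurable_times[OF mehler_measurable[OF h(1)] g(1)]]
    by (simp only: mehler_eq_normal_density[OF h(1) R] r_def)
  finally show ?thesis .
qed

text \<open>The standard normal law is stationary: the operator fixes the constant 1, and
  self-adjointness moves it there.\<close>

lemma mehler_mean:
  assumes "g \<in> borel_measurable borel" "\<And>x. \<bar>g x\<bar> \<le> K" "0 \<le> R" "R < 1"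
  shows "(\<integral>x. mehler R g x \<partial>std_normal_distribution) = (\<integral>x. g x \<partial>std_normal_distribution)"
proof -
  interpret real_distribution std_normal_distribution by (rule real_dist_normal_dist)
  have "mehler R (\<lambda>_. 1) x = 1" for x using prob_space by (simp add: mehler_def)
  then show ?thesis using mehler_selfadjoint[of g K "\<lambda>_. 1" 1 R] assms by simp
qed

text \<open>Coupling with the same noise \<open>z\<close>: the two arguments of \<open>g\<close>
  then differ by exactly \<open>R * (x - y)\<close>.\<close>

lemma mehler_lipschitz:
  assumes g: "g \<in> borel_measurable borel" "\<And>x. \<bar>g x\<bar> \<le> K" and R: "0 \<le> R"
    and lip: "\<And>x y. \<bar>g x - g y\<bar> \<le> C * \<bar>x - y\<bar>"
  shows "\<bar>mehler R g x - mehler R g y\<bar> \<le> C * R * \<bar>x - y\<bar>"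
proof -
  interpret real_distribution std_normal_distribution by (rule real_dist_normal_dist)
  note [measurable] = g(1)
  let ?t = "\<lambda>x z. R * x + sqrt (1 - R\<^sup>2) * z"
  have int: "integrable std_normal_distribution (\<lambda>z. g (?t x z))" for x
    by (intro integrable_std_normal_bounded[of _ K]) (use g in auto)
  have "\<bar>mehler R g x - mehler R g y\<bar> = \<bar>\<integral>z. g (?t x z) - g (?t y z) \<partial>std_normal_distribution\<bar>"
    unfolding mehler_def using int by simp
  also have "\<dots> \<le> (\<integral>z. \<bar>g (?t x z) - g (?t y z)\<bar> \<partial>std_normal_distribution)"
    by (rule integral_abs_bound)
  also have "\<dots> \<le> (\<integral>z. C * R * \<bar>x - y\<bar> \<partial>std_normal_distribution)"
  proof (intro integral_mono)
    show "integrable std_normal_distribution (\<lambda>z. \<bar>g (?t x z) - g (?t y z)\<bar>)" using int by auto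
    fix z
    have "?t x z - ?t y z = R * (x - y)" by (simp add: algebra_simps)
    then show "\<bar>g (?t x z) - g (?t y z)\<bar> \<le> C * R * \<bar>x - y\<bar>"
      using lip[of "?t x z" "?t y z"] R by (simp add: abs_mult ac_simps)
  qed auto
  finally show ?thesis using prob_space by simp
qed

text \<open>For means more than \<open>r\<close> apart, the trivial bound 2 suffices. For close
  means, the L1 distance is controlled by the chi-square divergence, which for normal laws of equal
  spread is \<open>exp (e\<^sup>2) - 1\<close> with \<open>e\<close> the distance of the means in
  units of \<open>r\<close>.\<close>

lemma integral_abs_diff_normal_density_le:
  assumes r: "r > 0"
  shows "(\<integral>y. \<bar>normal_density m r y - normal_density m' r y\<bar> \<partial>lborel) \<le> 2 * \<bar>m - m'\<bar> / r"
proof (cases "\<bar>m - m'\<bar> \<le> r")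
  case False
  have "(\<integral>y. \<bar>normal_density m r y - normal_density m' r y\<bar> \<partial>lborel)
     \<le> (\<integral>y. normal_density m r y + normal_density m' r y \<partial>lborel)"
    using r by (intro integral_mono) (auto intro: order.trans[OF abs_triangle_ineq4])
  also have "\<dots> = 2" using r by simp
  also have "2 \<le> 2 * \<bar>m - m'\<bar> / r" using False r by (simp add: field_simps)
  finally show ?thesis .
next
  case True
  show ?thesis
  proof (cases "m = m'")
    case False
    define e where "e = \<bar>m - m'\<bar> / r"
    have e: "0 < e" "e \<le> 1" using True False r by (auto simp: e_def)
    have e2: "(m - m')\<^sup>2 / r\<^sup>2 = e\<^sup>2" by (simp add: e_def power_divide)
    let ?p = "normal_density m r" and ?q = "normal_density m' r"
    let ?s = "normal_density (2 * m - m') r"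
    \<comment> \<open>\<open>p\<^sup>2 / q\<close> is again a normal density up to a constant; its
      mean is the reflection of \<open>m'\<close> in \<open>m\<close>.\<close>
    have key: "?p y * ?p y = exp (e\<^sup>2) * ?s y * ?q y" for y
    proof -
      have "- (y - m)\<^sup>2 / (2 * r\<^sup>2) + - (y - m)\<^sup>2 / (2 * r\<^sup>2)
        = (m - m')\<^sup>2 / r\<^sup>2 + - (y - (2 * m - m'))\<^sup>2 / (2 * r\<^sup>2) + - (y - m')\<^sup>2 / (2 * r\<^sup>2)"
        using r by (simp add: field_simps) (simp add: power2_eq_square algebra_simps)
      then show ?thesis
        by (simp add: normal_density_def e2 exp_add[symmetric])
    qed
    \<comment> \<open>AM-GM: \<open>2 \<bar>p - q\<bar> \<le> e q + (p - q)\<^sup>2 / (e q)\<close>\<close>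
    have pw: "\<bar>?p y - ?q y\<bar> \<le> (e * ?q y + (exp (e\<^sup>2) * ?s y - 2 * ?p y + ?q y) / e) / 2" for y
    proof -
      have q: "?q y > 0" using r by (rule normal_density_pos)
      have "0 \<le> (\<bar>?p y - ?q y\<bar> - e * ?q y)\<^sup>2" by simp
      also have "\<dots> = (?p y - ?q y)\<^sup>2 - 2 * e * ?q y * \<bar>?p y - ?q y\<bar> + e\<^sup>2 * (?q y)\<^sup>2"
        by (simp add: power2_diff power_mult_distrib)
      also have "(?p y - ?q y)\<^sup>2 = ?q y * (exp (e\<^sup>2) * ?s y - 2 * ?p y + ?q y)"
        using key[of y] by (simp add: power2_eq_square algebra_simps)
      finally have "?q y * (2 * e * \<bar>?p y - ?q y\<bar>) \<le> ?q y * ((exp (e\<^sup>2) * ?s y - 2 * ?p y + ?q y) + e\<^sup>2 * ?q y)"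
        by (simp add: algebra_simps power2_eq_square)
      then have "2 * e * \<bar>?p y - ?q y\<bar> \<le> (exp (e\<^sup>2) * ?s y - 2 * ?p y + ?q y) + e\<^sup>2 * ?q y"
        using q by simp
      then show ?thesis using e by (simp add: field_simps power2_eq_square)
    qed
    have "(\<integral>y. \<bar>?p y - ?q y\<bar> \<partial>lborel)
      \<le> (\<integral>y. (e * ?q y + (exp (e\<^sup>2) * ?s y - 2 * ?p y + ?q y) / e) / 2 \<partial>lborel)"
      using r by (intro integral_mono pw) auto
    also have "\<dots> = (e + (exp (e\<^sup>2) - 1) / e) / 2"
      using r by simp
    also have "\<dots> \<le> 2 * e"
    proof -
      have "exp (e\<^sup>2) \<le> 1 + e\<^sup>2 + (e\<^sup>2)\<^sup>2"
        using e by (intro exp_bound) (auto simp: power_le_one)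
      also have "(e\<^sup>2)\<^sup>2 \<le> e\<^sup>2" using e by (simp add: power2_eq_square mult_le_one mult_left_le)
      finally have "exp (e\<^sup>2) - 1 \<le> 2 * e\<^sup>2" by simp
      \<comment> \<open>The factor 3 is what makes the bound come out as
        \<open>(e + 3 * e) / 2 = 2 * e\<close>.\<close>
      then have "exp (e\<^sup>2) - 1 \<le> 3 * e\<^sup>2" using zero_le_power2[of e] by linarith
      then show ?thesis using e by (simp add: field_simps power2_eq_square)
    qed
    finally show ?thesis by (simp add: e_def)
  qed simp
qed

text \<open>Smoothing: \<open>x\<close> enters only through the mean of the transition density,
  which is Lipschitz in L1, and \<open>g\<close> is bounded by \<open>K\<close>.\<close>

lemma mehler_lipschitz_of_bounded:
  assumes g: "g \<in> borel_measurable borel" "\<And>x. \<bar>g x\<bar> \<le> K" and R: "0 \<le> R" "R < 1"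
  shows "\<bar>mehler R g x - mehler R g y\<bar> \<le> 2 * K / sqrt (1 - R\<^sup>2) * R * \<bar>x - y\<bar>"
proof -
  define r where "r = sqrt (1 - R\<^sup>2)"
  have r: "r > 0" unfolding r_def by (rule sqrt_one_minus_square_pos) (use R in auto)
  note [measurable] = g(1)
  have K: "K \<ge> 0" using g(2)[of 0] by simp
  let ?d = "\<lambda>x. normal_density (R * x) r"
  have int: "integrable lborel (\<lambda>u. ?d x u * g u)" for x
  proof (rule Bochner_Integration.integrable_bound[of _ "\<lambda>u. K * ?d x u"])
    show "AE u in lborel. norm (?d x u * g u) \<le> norm (K * ?d x u)"
      using g(2) K by (auto simp: abs_mult mult.commute intro!: mult_right_mono)
  qed (use r in auto)
  have "\<bar>mehler R g x - mehler R g y\<bar> = \<bar>\<integral>u. ?d x u * g u - ?d y u * g u \<partial>lborel\<bar>"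
    using g R int by (simp add: mehler_eq_normal_density r_def[symmetric])
  also have "\<dots> \<le> (\<integral>u. \<bar>?d x u * g u - ?d y u * g u\<bar> \<partial>lborel)"
    by (rule integral_abs_bound)
  also have "\<dots> \<le> (\<integral>u. K * \<bar>?d x u - ?d y u\<bar> \<partial>lborel)"
  proof (intro integral_mono)
    fix u
    have "\<bar>?d x u * g u - ?d y u * g u\<bar> = \<bar>g u\<bar> * \<bar>?d x u - ?d y u\<bar>"
      by (simp add: abs_mult[symmetric] algebra_simps)
    then show "\<bar>?d x u * g u - ?d y u * g u\<bar> \<le> K * \<bar>?d x u - ?d y u\<bar>"
      using g(2) by (simp add: mult_right_mono)
  qed (use int r in auto)
  also have "\<dots> \<le> K * (2 * \<bar>R * x - R * y\<bar> / r)"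
    using mult_left_mono[OF integral_abs_diff_normal_density_le[OF r, of "R * x" "R * y"] K] by simp
  also have "\<bar>R * x - R * y\<bar> = R * \<bar>x - y\<bar>" using R by (simp add: abs_mult flip: right_diff_distrib)
  finally show ?thesis by (simp add: r_def ac_simps)
qed

text \<open>A crude Poincare inequality. Being centered, \<open>g x\<close> is the average of
  \<open>g x - g z\<close> over \<open>z\<close>, hence at most
  \<open>C * (\<bar>x\<bar> + 1)\<close> in absolute value. The constant 4 is harmless: only the
  growth rate along the iterates matters later.\<close>

lemma std_normal_lipschitz_second_moment_le:
  assumes g: "g \<in> borel_measurable borel" "\<And>x. \<bar>g x\<bar> \<le> K"
    and lip: "\<And>x y. \<bar>g x - g y\<bar> \<le> C * \<bar>x - y\<bar>"
    and mean: "(\<integral>x. g x \<partial>std_normal_distribution) = 0"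
  shows "(\<integral>x. (g x)\<^sup>2 \<partial>std_normal_distribution) \<le> 4 * C\<^sup>2"
proof -
  interpret real_distribution std_normal_distribution by (rule real_dist_normal_dist)
  note [measurable] = g(1)
  have C: "C \<ge> 0" using lip[of 0 1] by simp
  have int: "integrable std_normal_distribution g" by (rule integrable_std_normal_bounded[OF g])
  have int2: "integrable std_normal_distribution (\<lambda>x. x\<^sup>2)"
    by (rule integrable_std_normal_distribution_moment)
  have m2: "(\<integral>x. x\<^sup>2 \<partial>std_normal_distribution) = 1"
    using std_normal_distribution_even_moments[of 1] by (simp add: fact_numeral)
  have int1: "integrable std_normal_distribution (\<lambda>x. \<bar>x\<bar>)"
    using integrable_std_normal_distribution_moment[of 1] by simp
  have "(\<integral>x. \<bar>x\<bar> \<partial>std_normal_distribution) \<le> (\<integral>x. (1 + x\<^sup>2) / 2 \<partial>std_normal_distribution)"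
  proof (intro integral_mono int1)
    show "\<bar>x\<bar> \<le> (1 + x\<^sup>2) / 2" for x :: real
      using zero_le_power2[of "\<bar>x\<bar> - 1"] by (simp add: power2_diff)
  qed (use int2 in auto)
  also have "\<dots> = 1" using int2 m2 prob_space by simp
  finally have m1: "(\<integral>x. \<bar>x\<bar> \<partial>std_normal_distribution) \<le> 1" .
  have gx: "\<bar>g x\<bar> \<le> C * (\<bar>x\<bar> + 1)" for x
  proof -
    have "g x = (\<integral>z. g x - g z \<partial>std_normal_distribution)" using int mean prob_space by simp
    then have "\<bar>g x\<bar> \<le> (\<integral>z. \<bar>g x - g z\<bar> \<partial>std_normal_distribution)"
      by (metis integral_abs_bound)
    also have "\<dots> \<le> (\<integral>z. C * (\<bar>x\<bar> + \<bar>z\<bar>) \<partial>std_normal_distribution)"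
    proof (intro integral_mono)
      fix z
      show "\<bar>g x - g z\<bar> \<le> C * (\<bar>x\<bar> + \<bar>z\<bar>)"
        using lip[of x z] C by (meson abs_triangle_ineq4 mult_left_mono order.trans)
    qed (use int int1 in auto)
    also have "\<dots> = C * (\<bar>x\<bar> + (\<integral>z. \<bar>z\<bar> \<partial>std_normal_distribution))"
      using int1 prob_space by simp
    also have "\<dots> \<le> C * (\<bar>x\<bar> + 1)" using m1 C by (intro mult_left_mono) auto
    finally show ?thesis .
  qed
  have "(\<integral>x. (g x)\<^sup>2 \<partial>std_normal_distribution) \<le> (\<integral>x. C\<^sup>2 * (2 * x\<^sup>2 + 2) \<partial>std_normal_distribution)"
  proof (intro integral_mono)
    show "integrable std_normal_distribution (\<lambda>x. (g x)\<^sup>2)"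
      by (rule integrable_std_normal_bounded[of _ "K\<^sup>2"]) (use order.trans[OF g(2) abs_ge_self] in \<open>auto simp: abs_le_square_iff[symmetric]\<close>)
    fix x :: real
    have "(g x)\<^sup>2 \<le> (C * (\<bar>x\<bar> + 1))\<^sup>2" using gx[of x] C by (intro abs_le_square_iff[THEN iffD1]) simp
    also have "\<dots> = C\<^sup>2 * (\<bar>x\<bar> + 1)\<^sup>2" by (rule power_mult_distrib)
    also have "(\<bar>x\<bar> + 1)\<^sup>2 \<le> 2 * x\<^sup>2 + 2"
      using zero_le_power2[of "\<bar>x\<bar> - 1"] by (simp add: power2_diff power2_sum)
    finally show "(g x)\<^sup>2 \<le> C\<^sup>2 * (2 * x\<^sup>2 + 2)" by (simp add: mult_left_mono)
  qed (use int2 in auto)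
  also have "\<dots> = 4 * C\<^sup>2" using int2 m2 prob_space by simp
  finally show ?thesis .
qed

text \<open>The spectral gap, obtained without Hermite expansion:
  \<open>log_convex_first_ratio_le\<close> is applied with rate \<open>R\<^sup>2\<close> to the
  squared norms \<open>b n\<close> of the iterates.\<close>

lemma mehler_contraction:
  assumes g: "g \<in> borel_measurable borel" "\<And>x. \<bar>g x\<bar> \<le> K" and R: "0 \<le> R" "R < 1"
    and mean: "(\<integral>x. g x \<partial>std_normal_distribution) = 0"
  shows "(\<integral>x. (mehler R g x)\<^sup>2 \<partial>std_normal_distribution)
    \<le> R\<^sup>2 * (\<integral>x. (g x)\<^sup>2 \<partial>std_normal_distribution)"
proof (cases "R = 0")
  case True
  \<comment> \<open>For \<open>R = 0\<close> the operator returns the constant mean of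
    \<open>g\<close>, which is 0; the growth argument needs a positive rate.\<close>
  then show ?thesis using mean by (simp add: mehler_def)
next
  case False
  with R have "0 < R" by simp
  define G where "G n = (mehler R ^^ n) g" for n
  have GS: "G (Suc n) = mehler R (G n)" for n by (simp add: G_def)
  have G0: "G 0 = g" by (simp add: G_def)
  have meas [measurable]: "G n \<in> borel_measurable borel" for n
    by (induction n) (auto simp: GS G0 g)
  have bd: "\<bar>G n x\<bar> \<le> K" for n x
    by (induction n arbitrary: x) (auto simp: GS G0 g meas intro!: mehler_bounded)
  have mean0: "(\<integral>x. G n x \<partial>std_normal_distribution) = 0" for n
    by (induction n) (use mehler_mean[OF meas bd] R mean in \<open>auto simp: GS G0\<close>)
  define c where "c = 2 * K / sqrt (1 - R\<^sup>2)"
  have lip: "\<bar>G (Suc n) x - G (Suc n) y\<bar> \<le> c * R ^ Suc n * \<bar>x - y\<bar>" for n x y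
  proof (induction n arbitrary: x y)
    case 0
    then show ?case using mehler_lipschitz_of_bounded[OF g] R by (simp add: GS G0 c_def)
  next
    case (Suc n)
    show ?case using mehler_lipschitz[OF meas bd _ Suc, of R x y] R by (simp add: GS ac_simps)
  qed
  define b where "b n = (\<integral>x. (G n x)\<^sup>2 \<partial>std_normal_distribution)" for n
  have sqint: "integrable std_normal_distribution (\<lambda>x. (G n x)\<^sup>2)" for n
    by (rule integrable_std_normal_bounded[of _ "K\<^sup>2"])
      (use order.trans[OF bd abs_ge_self] in \<open>auto simp: abs_le_square_iff[symmetric]\<close>)
  have "b 1 \<le> R\<^sup>2 * b 0"
  proof (rule log_convex_first_ratio_le)
    show "0 \<le> b n" for n by (simp add: b_def)
    show "(b (Suc n))\<^sup>2 \<le> b n * b (Suc (Suc n))" for n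
    proof -
      \<comment> \<open>Self-adjointness shifts one application from one factor to the other, after
        which Cauchy-Schwarz gives log-convexity.\<close>
      have "b (Suc n) = (\<integral>x. G (Suc n) x * mehler R (G n) x \<partial>std_normal_distribution)"
        by (simp add: b_def GS power2_eq_square)
      also have "\<dots> = (\<integral>x. mehler R (G (Suc n)) x * G n x \<partial>std_normal_distribution)"
        by (rule mehler_selfadjoint[OF meas bd meas bd]) (use R in auto)
      also have "\<dots> = (\<integral>x. G n x * G (Suc (Suc n)) x \<partial>std_normal_distribution)"
        by (simp add: GS mult.commute)
      finally show ?thesis
        using integral_mult_Cauchy_Schwarz(2)[OF _ _ sqint sqint, of n "Suc (Suc n)"] by (simp add: b_def)
    qed
    \<comment> \<open>The Lipschitz estimate starts at \<open>n = 1\<close>; the summand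
      \<open>b 0\<close> covers \<open>n = 0\<close>.\<close>
    show "b n \<le> (b 0 + 4 * c\<^sup>2) * (R\<^sup>2) ^ n" for n
    proof (cases n)
      case 0
      then show ?thesis by simp
    next
      case (Suc m)
      have "b n \<le> 4 * (c * R ^ n)\<^sup>2" unfolding b_def Suc
        by (rule std_normal_lipschitz_second_moment_le[OF meas bd lip mean0])
      also have "\<dots> = 4 * c\<^sup>2 * (R\<^sup>2) ^ n" by (simp add: power_mult_distrib flip: power_mult) (simp add: mult.commute)
      also have "\<dots> \<le> (b 0 + 4 * c\<^sup>2) * (R\<^sup>2) ^ n" by (intro mult_right_mono) (auto simp: b_def)
      finally show ?thesis .
    qed
    show "0 < R\<^sup>2" using \<open>0 < R\<close> by simp
  qed
  then show ?thesis by (simp add: b_def GS G0)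
qed

subsection \<open>Independence from characteristic functions\<close>

text \<open>The image under \<open>V\<close> of the signed measure with density \<open>Z\<close> has
  vanishing Fourier transform. Its positive and negative parts have equal mass \<open>c\<close>, so
  after division by \<open>c\<close> they are probability laws with the same characteristic
  function, and Levy's uniqueness theorem identifies them.\<close>

lemma integral_indicator_eq_0_of_char_real:
  fixes V Z :: "'a \<Rightarrow> real"
  assumes V[measurable]: "V \<in> borel_measurable M" and Z: "integrable M Z"
    and char0: "\<And>s. (\<integral>x. iexp (s * V x) * Z x \<partial>M) = 0" and B: "B \<in> sets borel"
  shows "(\<integral>x. indicator B (V x) * Z x \<partial>M) = 0"
proof -
  note [measurable] = B borel_measurable_integrable[OF Z]
  have Zc: "(\<integral>x. Z x \<partial>M) = 0"
    using char0[of 0] by simp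
  have int_max: "integrable M (\<lambda>x. max 0 (t * Z x))" for t :: real using Z by simp
  define c where "c = (\<integral>x. max 0 (Z x) \<partial>M)"
  have c': "(\<integral>x. max 0 (- Z x) \<partial>M) = c"
  proof -
    have "c - (\<integral>x. max 0 (- Z x) \<partial>M) = (\<integral>x. max 0 (Z x) - max 0 (- Z x) \<partial>M)"
      using int_max[of 1] int_max[of "-1"] by (simp add: c_def)
    also have "(\<lambda>x. max 0 (Z x) - max 0 (- Z x)) = Z" by (auto simp: fun_eq_iff max_def)
    finally show ?thesis using Zc by simp
  qed
  have bexp: "integrable M (\<lambda>x. iexp (s * V x) * complex_of_real (z x))"
    if "integrable M z" for s z
  proof (rule Bochner_Integration.integrable_bound[of _ z])
    show "(\<lambda>x. iexp (s * V x) * complex_of_real (z x)) \<in> borel_measurable M"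
      using borel_measurable_integrable[OF that] by measurable
  qed (use that in \<open>auto simp: norm_mult\<close>)
  have bind: "integrable M (\<lambda>x. indicator B (V x) * z x)" if "integrable M z" for z :: "'a \<Rightarrow> real"
  proof (rule Bochner_Integration.integrable_bound[of _ z])
    show "(\<lambda>x. indicator B (V x) * z x) \<in> borel_measurable M"
      using borel_measurable_integrable[OF that] by measurable
  qed (use that in \<open>auto simp: indicator_def\<close>)
  have split: "Z x = max 0 (Z x) - max 0 (- Z x)" for x by (auto simp: max_def)
  have "c \<ge> 0" by (simp add: c_def)
  show ?thesis
  proof (cases "c = 0")
    \<comment> \<open>No normalization is possible here, but \<open>Z\<close> vanishes almost
      everywhere.\<close>
    case True
    have "AE x in M. max 0 (Z x) = 0"
      using integral_nonneg_eq_0_iff_AE[of M "\<lambda>x. max 0 (Z x)"] int_max[of 1] True by (simp add: c_def)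
    moreover have "AE x in M. max 0 (- Z x) = 0"
      using integral_nonneg_eq_0_iff_AE[of M "\<lambda>x. max 0 (- Z x)"] int_max[of "-1"] True c' by simp
    ultimately have "AE x in M. Z x = 0" by eventually_elim (auto simp: max_def split: if_splits)
    then have "AE x in M. indicator B (V x) * Z x = 0" by eventually_elim simp
    then show ?thesis by (rule integral_eq_zero_AE)
  next
    case False
    with \<open>c \<ge> 0\<close> have c: "c > 0" by simp
    \<comment> \<open>The law of \<open>V\<close> under the probability with density
      \<open>z / c\<close>.\<close>
    define D where "D z = distr (density M (\<lambda>x. ennreal (z x / c))) borel V" for z :: "'a \<Rightarrow> real"
    have D: "real_distribution (D z) \<and> char (D z) = (\<lambda>s. (\<integral>x. iexp (s * V x) * z x \<partial>M) / c)
        \<and> measure (D z) B = (\<integral>x. indicator B (V x) * z x \<partial>M) / c"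
      if z: "integrable M z" "\<And>x. z x \<ge> 0" "(\<integral>x. z x \<partial>M) = c" for z
    proof -
      have [measurable]: "z \<in> borel_measurable M" using z by auto
      let ?d = "density M (\<lambda>x. ennreal (z x / c))"
      have "emeasure ?d (space ?d) = (\<integral>\<^sup>+x. ennreal (z x / c) \<partial>M)"
        by (simp add: emeasure_density cong: nn_integral_cong)
      also have "\<dots> = ennreal (\<integral>x. z x / c \<partial>M)"
        using z c by (intro nn_integral_eq_integral) auto
      also have "\<dots> = 1" using z c by simp
      finally interpret d: prob_space ?d by (rule prob_spaceI)
      interpret D: prob_space "D z" unfolding D_def by (rule d.prob_space_distr) simp
      have rd: "real_distribution (D z)" by standard (auto simp: D_def)
      have "char (D z) s = (\<integral>x. iexp (s * V x) * z x \<partial>M) / c" for s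
      proof -
        have "char (D z) s = (\<integral>x. (z x / c) *\<^sub>R iexp (s * V x) \<partial>M)"
          unfolding char_def D_def using z c by (simp add: integral_distr integral_density)
        also have "\<dots> = (\<integral>x. iexp (s * V x) * z x / c \<partial>M)"
          by (simp add: scaleR_conv_of_real ac_simps)
        finally show ?thesis by simp
      qed
      moreover have "measure (D z) B = (\<integral>x. indicator B (V x) * z x \<partial>M) / c"
      proof -
        have "measure (D z) B = (\<integral>x. indicator B x \<partial>D z)"
          by (simp add: D.emeasure_eq_measure D_def)
        also have "\<dots> = (\<integral>x. (z x / c) *\<^sub>R indicator B (V x) \<partial>M)"
          unfolding D_def using z c by (subst integral_distr, simp, simp, subst integral_density) auto
        also have "\<dots> = (\<integral>x. indicator B (V x) * z x / c \<partial>M)" by (simp add: ac_simps)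
        finally show ?thesis by simp
      qed
      ultimately show ?thesis using rd by auto
    qed
    note P = D[of "\<lambda>x. max 0 (Z x)", OF _ _ c_def[symmetric]]
    note N = D[of "\<lambda>x. max 0 (- Z x)", OF _ _ c']
    have ip: "integrable M (\<lambda>x. max 0 (Z x))" and "in": "integrable M (\<lambda>x. max 0 (- Z x))"
      using int_max[of 1] int_max[of "-1"] by simp_all
    have "char (D (\<lambda>x. max 0 (Z x))) = char (D (\<lambda>x. max 0 (- Z x)))"
    proof
      fix s
      have "(\<integral>x. iexp (s * V x) * complex_of_real (max 0 (Z x)) \<partial>M)
          - (\<integral>x. iexp (s * V x) * complex_of_real (max 0 (- Z x)) \<partial>M)
        = (\<integral>x. iexp (s * V x) * complex_of_real (max 0 (Z x)) - iexp (s * V x) * complex_of_real (max 0 (- Z x)) \<partial>M)"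
        by (rule Bochner_Integration.integral_diff[symmetric]) (intro bexp ip "in")+
      also have "\<dots> = (\<integral>x. iexp (s * V x) * Z x \<partial>M)"
        by (subst (2) split) (simp add: right_diff_distrib del: of_real_mult)
      finally show "char (D (\<lambda>x. max 0 (Z x))) s = char (D (\<lambda>x. max 0 (- Z x))) s"
        using P N ip "in" char0[of s] by simp
    qed
    then have "D (\<lambda>x. max 0 (Z x)) = D (\<lambda>x. max 0 (- Z x))"
      using P N ip "in" by (intro Levy_uniqueness) auto
    then have "(\<integral>x. indicator B (V x) * max 0 (Z x) \<partial>M) = (\<integral>x. indicator B (V x) * max 0 (- Z x) \<partial>M)"
      using P N ip "in" c by simp
    moreover have "(\<integral>x. indicator B (V x) * Z x \<partial>M)
       = (\<integral>x. indicator B (V x) * max 0 (Z x) - indicator B (V x) * max 0 (- Z x) \<partial>M)"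
      by (subst split) (simp add: right_diff_distrib)
    ultimately show ?thesis
      using bind[OF ip] bind[OF "in"] by simp
  qed
qed

text \<open>Conjugation turns the hypothesis at \<open>- s\<close> into the same statement for
  \<open>cnj Z\<close> at \<open>s\<close>; hence real and imaginary parts satisfy the real
  version.\<close>

lemma integral_indicator_eq_0_of_char:
  fixes V :: "'a \<Rightarrow> real" and Z :: "'a \<Rightarrow> complex"
  assumes V[measurable]: "V \<in> borel_measurable M" and Z: "integrable M Z"
    and char0: "\<And>s. (\<integral>x. iexp (s * V x) * Z x \<partial>M) = 0" and B: "B \<in> sets borel"
  shows "(\<integral>x. indicator B (V x) * Z x \<partial>M) = 0"
proof -
  note [measurable] = B borel_measurable_integrable[OF Z]
  have int: "integrable M (\<lambda>x. iexp (s * V x) * z x)" if "integrable M z" for s and z :: "'a \<Rightarrow> complex"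
  proof (rule Bochner_Integration.integrable_bound[of _ z])
    show "(\<lambda>x. iexp (s * V x) * z x) \<in> borel_measurable M"
      using borel_measurable_integrable[OF that] by measurable
  qed (use that in \<open>auto simp: norm_mult\<close>)
  have Zc: "integrable M (\<lambda>x. cnj (Z x))" using Z by simp
  have cnj0: "(\<integral>x. iexp (s * V x) * cnj (Z x) \<partial>M) = 0" for s
  proof -
    have "(\<integral>x. iexp (s * V x) * cnj (Z x) \<partial>M) = (\<integral>x. cnj (iexp ((- s) * V x) * Z x) \<partial>M)"
      by (simp add: exp_cnj)
    also have "\<dots> = cnj (\<integral>x. iexp ((- s) * V x) * Z x \<partial>M)" by (rule Bochner_Integration.integral_cnj)
    finally show ?thesis using char0[of "- s"] by simp
  qed
  have re: "(\<integral>x. indicator B (V x) * Re (Z x) \<partial>M) = 0"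
  proof (rule integral_indicator_eq_0_of_char_real[OF V _ _ B])
    show "(\<integral>x. iexp (s * V x) * Re (Z x) \<partial>M) = 0" for s
    proof -
      have "(\<integral>x. iexp (s * V x) * Re (Z x) \<partial>M)
          = (\<integral>x. (iexp (s * V x) * Z x + iexp (s * V x) * cnj (Z x)) / 2 \<partial>M)"
        by (simp add: complex_add_cnj flip: distrib_left)
      also have "\<dots> = 0" using int[OF Z] int[OF Zc] char0 cnj0 by simp
      finally show ?thesis .
    qed
  qed (use Z in auto)
  have im: "(\<integral>x. indicator B (V x) * Im (Z x) \<partial>M) = 0"
  proof (rule integral_indicator_eq_0_of_char_real[OF V _ _ B])
    show "(\<integral>x. iexp (s * V x) * Im (Z x) \<partial>M) = 0" for s
    proof -
      have "(\<integral>x. iexp (s * V x) * Im (Z x) \<partial>M)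
          = (\<integral>x. (iexp (s * V x) * Z x - iexp (s * V x) * cnj (Z x)) / (2 * \<i>) \<partial>M)"
        by (intro Bochner_Integration.integral_cong refl)
          (simp only: right_diff_distrib[symmetric] complex_diff_cnj, simp add: ac_simps)
      also have "\<dots> = 0" using int[OF Z] int[OF Zc] char0 cnj0 by simp
      finally show ?thesis .
    qed
  qed (use Z in auto)
  have "integrable M (\<lambda>x. indicator B (V x) * Z x)"
    by (rule Bochner_Integration.integrable_bound[OF Z]) (auto simp: indicator_def)
  moreover have "Re (indicator B y) = indicator B y" "Im (indicator B y) = 0" for y
    by (auto simp: indicator_def)
  ultimately show ?thesis
    using integral_Re[of M "\<lambda>x. indicator B (V x) * Z x"] integral_Im[of M "\<lambda>x. indicator B (V x) * Z x"] re im
    by (simp add: complex_eq_iff)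
qed

text \<open>The one-dimensional case replaces exponentials by indicators one coordinate at a time.
  This gives boxes, and a Dynkin system argument extends them to all Borel sets.\<close>

lemma integral_indicator_eq_0_of_char_euclidean:
  fixes X :: "'a \<Rightarrow> 'b::euclidean_space" and Z :: "'a \<Rightarrow> complex"
  assumes X[measurable]: "X \<in> borel_measurable M" and Z: "integrable M Z"
    and char0: "\<And>u. (\<integral>x. iexp (u \<bullet> X x) * Z x \<partial>M) = 0" and A: "A \<in> sets borel"
  shows "(\<integral>x. indicator A (X x) * Z x \<partial>M) = 0"
proof -
  note [measurable] = borel_measurable_integrable[OF Z]
  \<comment> \<open>The frequency \<open>u\<close> stays free in the induction, so that an
    exponential in the next coordinate \<open>j\<close> can be absorbed into it as
    \<open>u + s *\<^sub>R j\<close>.\<close>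
  have cyl: "(\<integral>x. (\<Prod>i\<in>S. indicator (B i) (X x \<bullet> i)) * (iexp (u \<bullet> X x) * Z x) \<partial>M) = 0"
    if "finite S" "\<And>i. B i \<in> sets borel" for S u and B :: "'b \<Rightarrow> real set"
    using that
  proof (induction S arbitrary: u rule: finite_induct)
    case empty
    then show ?case using char0 by simp
  next
    case (insert j S)
    note [measurable] = insert.prems
    let ?Z = "\<lambda>u x. (\<Prod>i\<in>S. indicator (B i) (X x \<bullet> i)) * (iexp (u \<bullet> X x) * Z x)"
    have "integrable M (?Z u)"
    proof (rule Bochner_Integration.integrable_bound[OF Z])
      have "norm (\<Prod>i\<in>S. indicator (B i) (X x \<bullet> i) :: complex) \<le> 1" for x
        unfolding prod_norm[symmetric] by (intro prod_le_1) (auto simp: indicator_def)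
      then show "AE x in M. norm (?Z u x) \<le> norm (Z x)"
        by (auto simp: norm_mult mult_left_le_one_le)
    qed measurable
    moreover have "(\<integral>x. iexp (s * (X x \<bullet> j)) * ?Z u x \<partial>M) = 0" for s
    proof -
      have "iexp (s * (X x \<bullet> j)) * ?Z u x = ?Z (u + s *\<^sub>R j) x" for x
      proof -
        have "(u + s *\<^sub>R j) \<bullet> X x = s * (X x \<bullet> j) + u \<bullet> X x"
          by (simp add: inner_add_left inner_commute[of j])
        then show ?thesis by (simp add: exp_add distrib_left)
      qed
      then show ?thesis using insert.IH[of "u + s *\<^sub>R j"] insert.prems by (simp only:)
    qed
    ultimately have "(\<integral>x. indicator (B j) (X x \<bullet> j) * ?Z u x \<partial>M) = 0"
      using insert.prems by (intro integral_indicator_eq_0_of_char) auto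
    then show ?case using insert.hyps by (simp add: mult.assoc)
  qed
  have box: "(\<integral>x. indicator (box a b) (X x) * Z x \<partial>M) = 0" for a b
  proof -
    have "indicator (box a b) y = (\<Prod>i\<in>Basis. indicator {a \<bullet> i <..< b \<bullet> i} (y \<bullet> i) :: complex)" for y
      by (auto simp: indicator_def box_def prod_zero_iff)
    then show ?thesis using cyl[of Basis "\<lambda>i. {a \<bullet> i <..< b \<bullet> i}" 0] by simp
  qed
  have int: "integrable M (\<lambda>x. indicator A (X x) * Z x)" if [measurable]: "A \<in> sets borel" for A
    by (rule Bochner_Integration.integrable_bound[OF Z]) (auto simp: indicator_def)
  let ?G = "range (\<lambda>(a, b). box a b :: 'b set)"
  have sets_borel: "sets (borel :: 'b measure) = sigma_sets UNIV ?G"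
    by (subst borel_eq_box) simp
  have "Int_stable ?G" by (auto simp: Int_stable_def box_Int_box)
  moreover have "?G \<subseteq> Pow UNIV" by simp
  moreover have "A \<in> sigma_sets UNIV ?G" using A sets_borel by simp
  ultimately show ?thesis
  proof (induction rule: sigma_sets_induct_disjoint)
    case (basic A)
    then show ?case using box by auto
  next
    case empty
    then show ?case by simp
  next
    case (compl A)
    then have "A \<in> sets borel" using sets_borel by simp
    have "(\<integral>x. indicator (UNIV - A) (X x) * Z x \<partial>M) = (\<integral>x. Z x - indicator A (X x) * Z x \<partial>M)"
      by (intro Bochner_Integration.integral_cong) (auto simp: indicator_def)
    also have "\<dots> = (\<integral>x. Z x \<partial>M)" using compl Z int[OF \<open>A \<in> sets borel\<close>] by simp
    also have "\<dots> = 0" using char0[of 0] by simp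
    finally show ?case .
  next
    case (union A)
    have A: "A i \<in> sets borel" for i using union sets_borel by auto
    note [measurable] = A
    let ?A = "\<lambda>i. X -` A i \<inter> space M"
    have eq: "(\<integral>x. indicator B (X x) * Z x \<partial>M) = (LINT x:X -` B \<inter> space M|M. Z x)" for B
      unfolding set_lebesgue_integral_def
      by (intro Bochner_Integration.integral_cong) (auto simp: indicator_def)
    have "(LINT x:(\<Union>i. ?A i)|M. Z x) = (\<Sum>i. (LINT x:?A i|M. Z x))"
    proof (rule lebesgue_integral_countable_add)
      show "?A i \<in> sets M" for i by measurable
      show "?A i \<inter> ?A j = {}" if "i \<noteq> j" for i j
        using union(1) that by (auto simp: disjoint_family_on_def)
      show "set_integrable M (\<Union>i. ?A i) Z"
        unfolding set_integrable_def using Z by (intro integrable_mult_indicator) auto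
    qed
    moreover have "(\<Union>i. ?A i) = X -` (\<Union>i. A i) \<inter> space M" by auto
    ultimately show ?case using union(3) by (simp add: eq)
  qed
qed

text \<open>Kac's criterion for independence. The exponential in \<open>X\<close> is replaced by the
  indicator of \<open>A\<close> with \<open>t\<close> fixed, then the exponential in
  \<open>W\<close> by the indicator of \<open>B\<close>; rectangles determine the joint law.\<close>

lemma (in prob_space) distr_pair_eq_pair_measure_of_char:
  fixes X :: "'a \<Rightarrow> 'b::euclidean_space" and W :: "'a \<Rightarrow> real"
  assumes X[measurable]: "X \<in> borel_measurable M" and W[measurable]: "W \<in> borel_measurable M"
    and char: "\<And>u t. expectation (\<lambda>x. iexp (u \<bullet> X x + t * W x))
      = expectation (\<lambda>x. iexp (u \<bullet> X x)) * expectation (\<lambda>x. iexp (t * W x))"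
  shows "distr M (borel \<Otimes>\<^sub>M borel) (\<lambda>x. (X x, W x)) = distr M borel X \<Otimes>\<^sub>M distr M borel W"
proof -
  have iexp_int: "integrable M (\<lambda>x. iexp (h x))" if "h \<in> borel_measurable M" for h
    using that by (intro integrable_const_bound[of _ 1]) auto
  have AB: "prob (X -` A \<inter> space M \<inter> (W -` B \<inter> space M))
      = prob (X -` A \<inter> space M) * prob (W -` B \<inter> space M)"
    if A[measurable]: "A \<in> sets borel" and B[measurable]: "B \<in> sets borel" for A B
  proof -
    \<comment> \<open>By the factorization, the centered weight \<open>iexp (t * W x) - E\<close>
      has zero transform with respect to \<open>X\<close>.\<close>
    have step1: "(\<integral>x. indicator A (X x) * (iexp (t * W x) - expectation (\<lambda>x. iexp (t * W x))) \<partial>M) = 0" for t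
    proof (rule integral_indicator_eq_0_of_char_euclidean[OF X _ _ A])
      show "(\<integral>x. iexp (u \<bullet> X x) * (iexp (t * W x) - expectation (\<lambda>x. iexp (t * W x))) \<partial>M) = 0" for u
      proof -
        have "(\<integral>x. iexp (u \<bullet> X x) * (iexp (t * W x) - expectation (\<lambda>x. iexp (t * W x))) \<partial>M)
          = (\<integral>x. iexp (u \<bullet> X x + t * W x) - iexp (u \<bullet> X x) * expectation (\<lambda>x. iexp (t * W x)) \<partial>M)"
          by (simp add: right_diff_distrib exp_add distrib_left)
        also have "\<dots> = expectation (\<lambda>x. iexp (u \<bullet> X x + t * W x))
            - expectation (\<lambda>x. iexp (u \<bullet> X x)) * expectation (\<lambda>x. iexp (t * W x))"
          using iexp_int[of "\<lambda>x. u \<bullet> X x + t * W x"] iexp_int[of "\<lambda>x. u \<bullet> X x"]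
          by (subst Bochner_Integration.integral_diff) simp_all
        finally show ?thesis using char by simp
      qed
    qed (use iexp_int[of "\<lambda>x. t * W x"] in simp)
    let ?p = "prob (X -` A \<inter> space M)"
    let ?Z = "\<lambda>x. indicator A (X x) - complex_of_real ?p"
    have indA: "integrable M (\<lambda>x. indicator A (X x) * z x)" if "integrable M z" for z :: "'a \<Rightarrow> complex"
      using that borel_measurable_integrable[OF that]
      by (intro Bochner_Integration.integrable_bound[OF that]) (auto simp: indicator_def)
    have EA: "expectation (\<lambda>x. indicator C (Y x)) = complex_of_real (prob (Y -` C \<inter> space M))"
      if [measurable]: "Y \<in> measurable M N" "C \<in> sets N" for C :: "'c set" and Y N
    proof -
      have "expectation (\<lambda>x. indicator C (Y x)) = expectation (\<lambda>x. complex_of_real (indicator (Y -` C \<inter> space M) x))"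
        by (intro Bochner_Integration.integral_cong) (auto simp: indicator_def)
      also have "\<dots> = complex_of_real (prob (Y -` C \<inter> space M))"
        by (subst integral_complex_of_real) simp
      finally show ?thesis .
    qed
    \<comment> \<open>The roles are now exchanged: the weight is the centered indicator of
      \<open>A\<close>, the transform is taken in \<open>W\<close>.\<close>
    have "(\<integral>x. indicator B (W x) * ?Z x \<partial>M) = 0"
    proof (rule integral_indicator_eq_0_of_char[OF W _ _ B])
      show "integrable M ?Z" using indA[of "\<lambda>_. 1"] by simp
      fix t
      let ?e = "expectation (\<lambda>x. iexp (t * W x))"
      have "0 = (\<integral>x. indicator A (X x) * iexp (t * W x) - indicator A (X x) * ?e \<partial>M)"
        using step1[of t] by (simp add: right_diff_distrib)
      also have "\<dots> = (\<integral>x. indicator A (X x) * iexp (t * W x) \<partial>M) - ?p * ?e"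
        using indA[of "\<lambda>_. ?e"] indA[OF iexp_int, of "\<lambda>x. t * W x"] EA[OF X A] by simp
      finally have "(\<integral>x. indicator A (X x) * iexp (t * W x) \<partial>M) = ?p * ?e" by simp
      then show "(\<integral>x. iexp (t * W x) * ?Z x \<partial>M) = 0"
        using indA[OF iexp_int, of "\<lambda>x. t * W x"] iexp_int[of "\<lambda>x. t * W x"]
        by (simp add: right_diff_distrib mult.commute)
    qed
    moreover have "(\<integral>x. indicator B (W x) * ?Z x \<partial>M)
      = (\<integral>x. indicator (A \<times> B) (X x, W x) - indicator B (W x) * complex_of_real ?p \<partial>M)"
      by (intro Bochner_Integration.integral_cong) (auto simp: indicator_def)
    moreover have "\<dots> = (\<integral>x. indicator (A \<times> B) (X x, W x) \<partial>M) - (\<integral>x. indicator B (W x) * complex_of_real ?p \<partial>M)"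
    proof (rule Bochner_Integration.integral_diff)
      show "integrable M (\<lambda>x. indicator (A \<times> B) (X x, W x) :: complex)"
        by (intro integrable_const_bound[of _ 1]) (auto simp: indicator_def)
      show "integrable M (\<lambda>x. indicator B (W x) * complex_of_real ?p)"
        by (intro integrable_const_bound[of _ ?p]) (auto simp: indicator_def)
    qed
    ultimately have "complex_of_real (prob ((\<lambda>x. (X x, W x)) -` (A \<times> B) \<inter> space M))
        = complex_of_real (prob (W -` B \<inter> space M) * ?p)"
      using EA[OF W B] EA[of "\<lambda>x. (X x, W x)" "borel \<Otimes>\<^sub>M borel" "A \<times> B"] by simp
    then have "prob ((\<lambda>x. (X x, W x)) -` (A \<times> B) \<inter> space M) = ?p * prob (W -` B \<inter> space M)"
      unfolding of_real_eq_iff by (simp add: mult.commute)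
    moreover have "(\<lambda>x. (X x, W x)) -` (A \<times> B) \<inter> space M = X -` A \<inter> space M \<inter> (W -` B \<inter> space M)" by auto
    ultimately show ?thesis by simp
  qed
  interpret PX: prob_space "distr M borel X" by (rule prob_space_distr) simp
  interpret PW: prob_space "distr M borel W" by (rule prob_space_distr) simp
  show ?thesis
  proof (rule pair_measure_eqI[symmetric])
    fix A B assume "A \<in> sets (distr M borel X)" "B \<in> sets (distr M borel W)"
    then have [measurable]: "A \<in> sets borel" "B \<in> sets borel" by auto
    have "(\<lambda>x. (X x, W x)) -` (A \<times> B) \<inter> space M = X -` A \<inter> space M \<inter> (W -` B \<inter> space M)" by auto
    then show "emeasure (distr M borel X) A * emeasure (distr M borel W) B
        = emeasure (distr M (borel \<Otimes>\<^sub>M borel) (\<lambda>x. (X x, W x))) (A \<times> B)"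
      using AB[of A B] by (simp add: emeasure_distr emeasure_eq_measure ennreal_mult[symmetric])
  qed (auto simp: PX.sigma_finite_measure_axioms PW.sigma_finite_measure_axioms cong: sets_pair_measure_cong)
qed

subsection \<open>Correlation of functions of a Gaussian pair\<close>

text \<open>Independence allows integrating over \<open>Z\<close> first, which turns
  \<open>g\<close> into \<open>mehler R g (u (X x))\<close>. Cauchy-Schwarz and the contraction
  under the standard normal law of \<open>u (X x)\<close> finish the estimate.\<close>

lemma (in prob_space) std_normal_pair_correlation_le_of_bounded:
  assumes X[measurable]: "X \<in> measurable M N" and u[measurable]: "u \<in> borel_measurable N"
    and Z[measurable]: "Z \<in> borel_measurable M"
    and joint: "distr M (N \<Otimes>\<^sub>M borel) (\<lambda>x. (X x, Z x)) = distr M N X \<Otimes>\<^sub>M std_normal_distribution"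
    and U: "distr M borel (\<lambda>x. u (X x)) = std_normal_distribution"
    and R: "0 \<le> R" "R < 1"
    and f[measurable]: "f \<in> borel_measurable N" and f1: "integrable M (\<lambda>x. f (X x))"
    and f2: "integrable M (\<lambda>x. (f (X x))\<^sup>2)"
    and g[measurable]: "g \<in> borel_measurable borel" and gK: "\<And>y. \<bar>g y\<bar> \<le> K"
    and mean: "(\<integral>y. g y \<partial>std_normal_distribution) = 0"
  shows "expectation (\<lambda>x. f (X x) * g (R * u (X x) + sqrt (1 - R\<^sup>2) * Z x))
    \<le> R * sqrt (expectation (\<lambda>x. (f (X x))\<^sup>2)) * sqrt (\<integral>y. (g y)\<^sup>2 \<partial>std_normal_distribution)"
proof -
  interpret G: real_distribution std_normal_distribution by (rule real_dist_normal_dist)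
  interpret PX: prob_space "distr M N X" by (rule prob_space_distr) simp
  interpret PP: pair_sigma_finite "distr M N X" std_normal_distribution ..
  let ?h = "\<lambda>(x, z). f x * g (R * u x + sqrt (1 - R\<^sup>2) * z)"
  have hmeas: "?h \<in> borel_measurable (N \<Otimes>\<^sub>M borel)" by measurable
  have "integrable M (\<lambda>x. f (X x) * g (R * u (X x) + sqrt (1 - R\<^sup>2) * Z x))"
  proof (rule Bochner_Integration.integrable_bound[of _ "\<lambda>x. K * f (X x)"])
    have "\<bar>f x\<bar> * \<bar>g y\<bar> \<le> \<bar>K\<bar> * \<bar>f x\<bar>" for x y
      using mult_right_mono[OF order.trans[OF gK abs_ge_self], of "\<bar>f x\<bar>" y] by (simp add: mult.commute)
    then show "AE x in M. norm (f (X x) * g (R * u (X x) + sqrt (1 - R\<^sup>2) * Z x)) \<le> norm (K * f (X x))"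
      by (simp add: abs_mult)
  qed (use f1 in auto)
  then have "integrable (distr M (N \<Otimes>\<^sub>M borel) (\<lambda>x. (X x, Z x))) ?h"
    by (subst integrable_distr_eq[OF _ hmeas]) auto
  then have int: "integrable (distr M N X \<Otimes>\<^sub>M std_normal_distribution) ?h" by (simp add: joint)
  have "expectation (\<lambda>x. f (X x) * g (R * u (X x) + sqrt (1 - R\<^sup>2) * Z x))
      = (\<integral>p. ?h p \<partial>distr M (N \<Otimes>\<^sub>M borel) (\<lambda>x. (X x, Z x)))"
    by (subst integral_distr[OF _ hmeas]) auto
  also have "\<dots> = (\<integral>x. (\<integral>z. ?h (x, z) \<partial>std_normal_distribution) \<partial>distr M N X)"
    unfolding joint by (rule PP.integral_fst'[OF int, symmetric])
  also have "\<dots> = (\<integral>x. f x * mehler R g (u x) \<partial>distr M N X)"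
    by (simp add: mehler_def)
  also have "\<dots> = expectation (\<lambda>x. f (X x) * mehler R g (u (X x)))"
    by (subst integral_distr) auto
  finally have eq: "expectation (\<lambda>x. f (X x) * g (R * u (X x) + sqrt (1 - R\<^sup>2) * Z x))
      = expectation (\<lambda>x. f (X x) * mehler R g (u (X x)))" .
  have bd: "\<bar>mehler R g x\<bar> \<le> K" for x by (rule mehler_bounded[OF g gK])
  have "(expectation (\<lambda>x. f (X x) * mehler R g (u (X x))))\<^sup>2
    \<le> expectation (\<lambda>x. (f (X x))\<^sup>2) * expectation (\<lambda>x. (mehler R g (u (X x)))\<^sup>2)"
  proof (rule integral_mult_Cauchy_Schwarz(2)[OF _ _ f2])
    show "integrable M (\<lambda>x. (mehler R g (u (X x)))\<^sup>2)"
      by (rule integrable_const_bound[of _ "K\<^sup>2"])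
        (use order.trans[OF bd abs_ge_self] in \<open>auto simp: abs_le_square_iff[symmetric]\<close>)
  qed auto
  also have "expectation (\<lambda>x. (mehler R g (u (X x)))\<^sup>2) = (\<integral>y. (mehler R g y)\<^sup>2 \<partial>std_normal_distribution)"
    unfolding U[symmetric] by (subst integral_distr) auto
  also have "expectation (\<lambda>x. (f (X x))\<^sup>2) * \<dots>
     \<le> expectation (\<lambda>x. (f (X x))\<^sup>2) * (R\<^sup>2 * (\<integral>y. (g y)\<^sup>2 \<partial>std_normal_distribution))"
    by (intro mult_left_mono mehler_contraction[OF g gK R mean]) simp
  also have "\<dots> = (R * sqrt (expectation (\<lambda>x. (f (X x))\<^sup>2)) * sqrt (\<integral>y. (g y)\<^sup>2 \<partial>std_normal_distribution))\<^sup>2"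
    by (simp add: power_mult_distrib)
  finally show ?thesis
    unfolding eq by (rule power2_le_imp_le) (use R in simp)
qed

text \<open>Truncations \<open>t n\<close> of \<open>g\<close> are recentered by their means
  \<open>c n\<close> before the bounded case applies; dominated convergence then removes the
  truncation.\<close>

lemma (in prob_space) std_normal_pair_correlation_le:
  assumes X[measurable]: "X \<in> measurable M N" and u[measurable]: "u \<in> borel_measurable N"
    and Z[measurable]: "Z \<in> borel_measurable M"
    and joint: "distr M (N \<Otimes>\<^sub>M borel) (\<lambda>x. (X x, Z x)) = distr M N X \<Otimes>\<^sub>M std_normal_distribution"
    and U: "distr M borel (\<lambda>x. u (X x)) = std_normal_distribution"
    and Y: "distr M borel Y = std_normal_distribution"
    and Y_eq: "\<And>x. Y x = R * u (X x) + sqrt (1 - R\<^sup>2) * Z x"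
    and R: "0 \<le> R" "R < 1"
    and f[measurable]: "f \<in> borel_measurable N" and f1: "integrable M (\<lambda>x. f (X x))"
    and f2: "integrable M (\<lambda>x. (f (X x))\<^sup>2)" and f0: "expectation (\<lambda>x. f (X x)) = 0"
    and g[measurable]: "g \<in> borel_measurable borel" and g2: "integrable M (\<lambda>x. (g (Y x))\<^sup>2)"
  shows "expectation (\<lambda>x. f (X x) * g (Y x))
    \<le> R * sqrt (expectation (\<lambda>x. (f (X x))\<^sup>2)) * sqrt (expectation (\<lambda>x. (g (Y x))\<^sup>2))"
proof -
  interpret G: real_distribution std_normal_distribution by (rule real_dist_normal_dist)
  have Ym[measurable]: "Y \<in> borel_measurable M" unfolding Y_eq by measurable
  define t where "t n y = max (- real n) (min (real n) (g y))" for n y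
  have tm[measurable]: "t n \<in> borel_measurable borel" for n unfolding t_def by measurable
  have tn: "\<bar>t n y\<bar> \<le> real n" for n y by (auto simp: t_def)
  have tg: "\<bar>t n y\<bar> \<le> \<bar>g y\<bar>" for n y by (auto simp: t_def)
  define c where "c n = (\<integral>y. t n y \<partial>std_normal_distribution)" for n
  have tint: "integrable std_normal_distribution (t n)" for n
    by (rule integrable_std_normal_bounded[OF tm tn])
  have t2int: "integrable std_normal_distribution (\<lambda>y. (t n y)\<^sup>2)" for n
    by (rule integrable_std_normal_bounded[of _ "(real n)\<^sup>2"]) (use tn in \<open>auto simp: abs_le_square_iff[symmetric]\<close>)
  have fg: "integrable M (\<lambda>x. f (X x) * g (Y x))"
    by (rule integrable_mult_of_square_integrable[OF _ _ f2 g2]) auto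
  have ft: "integrable M (\<lambda>x. f (X x) * t n (Y x))" for n
    by (rule Bochner_Integration.integrable_bound[OF fg]) (use tg in \<open>auto simp: abs_mult intro!: mult_left_mono\<close>)
  have le: "expectation (\<lambda>x. f (X x) * t n (Y x))
    \<le> R * sqrt (expectation (\<lambda>x. (f (X x))\<^sup>2)) * sqrt (expectation (\<lambda>x. (g (Y x))\<^sup>2))" for n
  proof -
    \<comment> \<open>Subtracting the constant \<open>c n\<close> is free because \<open>f\<close>
      is centered.\<close>
    have "expectation (\<lambda>x. f (X x) * t n (Y x)) = expectation (\<lambda>x. f (X x) * (t n (Y x) - c n))"
      using ft f1 f0 by (simp add: right_diff_distrib)
    also have "\<dots> \<le> R * sqrt (expectation (\<lambda>x. (f (X x))\<^sup>2)) * sqrt (\<integral>y. (t n y - c n)\<^sup>2 \<partial>std_normal_distribution)"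
      unfolding Y_eq
    proof (rule std_normal_pair_correlation_le_of_bounded[OF X u Z joint U R f f1 f2])
      show "\<bar>t n y - c n\<bar> \<le> real n + \<bar>c n\<bar>" for y using tn[of n y] by linarith
      show "(\<integral>y. t n y - c n \<partial>std_normal_distribution) = 0"
        using tint G.prob_space by (simp add: c_def)
    qed auto
    also have "\<dots> \<le> R * sqrt (expectation (\<lambda>x. (f (X x))\<^sup>2)) * sqrt (expectation (\<lambda>x. (g (Y x))\<^sup>2))"
    proof (intro mult_left_mono real_sqrt_le_mono)
      \<comment> \<open>Recentering can only lower the second moment.\<close>
      have "(\<integral>y. (t n y - c n)\<^sup>2 \<partial>std_normal_distribution)
          = (\<integral>y. (t n y)\<^sup>2 - 2 * c n * t n y + (c n)\<^sup>2 \<partial>std_normal_distribution)"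
        by (simp add: power2_diff algebra_simps)
      also have "\<dots> = (\<integral>y. (t n y)\<^sup>2 \<partial>std_normal_distribution) - (c n)\<^sup>2"
        using tint t2int G.prob_space by (simp add: c_def[symmetric] power2_eq_square)
      also have "\<dots> \<le> (\<integral>y. (t n y)\<^sup>2 \<partial>std_normal_distribution)" by simp
      also have "\<dots> = expectation (\<lambda>x. (t n (Y x))\<^sup>2)"
        unfolding Y[symmetric] by (subst integral_distr) auto
      also have "\<dots> \<le> expectation (\<lambda>x. (g (Y x))\<^sup>2)"
      proof (rule integral_mono[OF _ g2])
        show "(t n (Y x))\<^sup>2 \<le> (g (Y x))\<^sup>2" for x using tg by (simp add: abs_le_square_iff[symmetric])
        show "integrable M (\<lambda>x. (t n (Y x))\<^sup>2)"
          by (rule integrable_const_bound[of _ "(real n)\<^sup>2"]) (use tn in \<open>auto simp: abs_le_square_iff[symmetric]\<close>)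
      qed
      finally show "(\<integral>y. (t n y - c n)\<^sup>2 \<partial>std_normal_distribution) \<le> expectation (\<lambda>x. (g (Y x))\<^sup>2)" .
    qed (use R in auto)
    finally show ?thesis .
  qed
  have "(\<lambda>n. expectation (\<lambda>x. f (X x) * t n (Y x))) \<longlonglongrightarrow> expectation (\<lambda>x. f (X x) * g (Y x))"
  proof (rule integral_dominated_convergence[of _ _ _ "\<lambda>x. \<bar>f (X x) * g (Y x)\<bar>"])
    have "(\<lambda>n. t n y) \<longlonglongrightarrow> g y" for y
    proof (rule tendsto_eventually)
      obtain k where "\<bar>g y\<bar> \<le> real k" using real_arch_simple by blast
      then show "\<forall>\<^sub>F n in sequentially. t n y = g y"
        unfolding eventually_sequentially by (intro exI[of _ k]) (auto simp: t_def)
    qed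
    then show "AE x in M. (\<lambda>n. f (X x) * t n (Y x)) \<longlonglongrightarrow> f (X x) * g (Y x)"
      by (intro AE_I2 tendsto_mult tendsto_const)
    show "AE x in M. norm (f (X x) * t n (Y x)) \<le> \<bar>f (X x) * g (Y x)\<bar>" for n
      using tg by (auto simp: abs_mult intro!: mult_left_mono)
  qed (use fg in auto)
  then show ?thesis by (rule LIMSEQ_le_const2) (use le in auto)
qed

text \<open>Expresses the unnamed parameters of a possibly degenerate normal law by expectation and
  variance, which the prescribed moments determine.\<close>

lemma (in prob_space) normal_law_char:
  assumes V[measurable]: "V \<in> borel_measurable M"
    and law: "\<exists>m \<sigma>. \<sigma> \<ge> 0 \<and> distr M lborel V =
      (if \<sigma> = 0 then return lborel m else density lborel (normal_density m \<sigma>))"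
  shows "expectation (\<lambda>x. iexp (V x)) = iexp (expectation V) * complex_of_real (exp (- variance V / 2))"
    and "variance V > 0 \<Longrightarrow>
      distr M borel (\<lambda>x. (V x - expectation V) / sqrt (variance V)) = std_normal_distribution"
proof -
  obtain m \<sigma> where \<sigma>: "\<sigma> \<ge> 0" and D: "distr M lborel V =
      (if \<sigma> = 0 then return lborel m else density lborel (normal_density m \<sigma>))" using law by blast
  have "expectation (\<lambda>x. iexp (V x)) = iexp (expectation V) * complex_of_real (exp (- variance V / 2)) \<and>
    (variance V > 0 \<longrightarrow>
      distr M borel (\<lambda>x. (V x - expectation V) / sqrt (variance V)) = std_normal_distribution)"
  proof (cases "\<sigma> = 0")
    case True
    have tr: "expectation (\<lambda>x. h (V x)) = h m" if [measurable]: "h \<in> borel_measurable borel"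
      for h :: "real \<Rightarrow> 'c::{banach,second_countable_topology}"
    proof -
      have "expectation (\<lambda>x. h (V x)) = (\<integral>v. h v \<partial>distr M lborel V)"
        by (subst integral_distr) auto
      also have "\<dots> = h m" using D True by (simp add: integral_return)
      finally show ?thesis .
    qed
    have "expectation V = m" using tr[of "\<lambda>v. v"] by simp
    then show ?thesis using tr[of "\<lambda>v. (v - m)\<^sup>2"] tr[of iexp] by simp
  next
    case False
    with \<sigma> have \<sigma>: "\<sigma> > 0" by simp
    have dist: "distributed M lborel V (normal_density m \<sigma>)"
      using D False unfolding distributed_def by simp
    have m: "expectation V = m" by (rule normal_distributed_expectation[OF \<sigma> dist])
    have v: "variance V = \<sigma>\<^sup>2" by (rule normal_distributed_variance[OF \<sigma> dist])
    let ?S = "\<lambda>x. (V x - m) / \<sigma>"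
    have "distributed M lborel ?S std_normal_density"
      using normal_standard_normal_convert[OF \<sigma>] dist by blast
    then have "distr M lborel ?S = std_normal_distribution" unfolding distributed_def by simp
    moreover have "distr M borel ?S = distr M lborel ?S" by (rule distr_cong) auto
    ultimately have S: "distr M borel ?S = std_normal_distribution" by simp
    have "expectation (\<lambda>x. iexp (V x)) = expectation (\<lambda>x. iexp m * iexp (\<sigma> * ?S x))"
      using \<sigma> by (intro Bochner_Integration.integral_cong refl)
        (simp add: exp_add[symmetric] distrib_left[symmetric] flip: of_real_add of_real_mult of_real_diff of_real_divide)
    also have "\<dots> = iexp m * expectation (\<lambda>x. iexp (\<sigma> * ?S x))" by simp
    also have "expectation (\<lambda>x. iexp (\<sigma> * ?S x)) = char std_normal_distribution \<sigma>"
      unfolding char_def S[symmetric] by (subst integral_distr) auto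
    also have "\<dots> = complex_of_real (exp (- variance V / 2))"
      by (simp add: char_std_normal_distribution v)
    finally show ?thesis using S \<sigma> v unfolding m by simp
  qed
  then show "expectation (\<lambda>x. iexp (V x)) = iexp (expectation V) * complex_of_real (exp (- variance V / 2))"
    and "variance V > 0 \<Longrightarrow>
      distr M borel (\<lambda>x. (V x - expectation V) / sqrt (variance V)) = std_normal_distribution"
    by blast+
qed

subsection \<open>Laws with given first and second moments\<close>

text \<open>The form may be singular: the part of \<open>l\<close> orthogonal to the range of the operator of \<open>B\<close> is a null
  direction of \<open>B\<close>, so it vanishes.\<close>
lemma bilinear_represents_functional:
  fixes B :: "'a::euclidean_space \<Rightarrow> 'a \<Rightarrow> real" and l :: "'a \<Rightarrow> real"
  assumes B: "bilinear B" and l: "linear l" and null: "\<And>x. B x x = 0 \<Longrightarrow> l x = 0"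
  obtains a where "\<And>s. B s a = l s"
proof -
  define S where "S s = (\<Sum>b\<in>Basis. B b s *\<^sub>R b)" for s
  define c where "c = (\<Sum>b\<in>Basis. l b *\<^sub>R b)"
  have linl: "linear (\<lambda>t. B t s)" and linr: "linear (B s)" for s using B by (auto simp: bilinear_def)
  \<comment> \<open>\<open>S\<close> is the operator of the form \<open>B\<close>, and
    \<open>c\<close> below is the Riesz vector of \<open>l\<close>.\<close>
  have S: "t \<bullet> S s = B t s" for t s
  proof -
    have "B t s = B (\<Sum>b\<in>Basis. (t \<bullet> b) *\<^sub>R b) s" by (simp add: euclidean_representation)
    also have "\<dots> = (\<Sum>b\<in>Basis. (t \<bullet> b) * B b s)"
      by (simp add: linear_sum[OF linl] linear_cmul[OF linl])
    finally show ?thesis by (simp add: S_def inner_sum_right mult.commute)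
  qed
  have c: "t \<bullet> c = l t" for t
  proof -
    have "l t = l (\<Sum>b\<in>Basis. (t \<bullet> b) *\<^sub>R b)" by (simp add: euclidean_representation)
    also have "\<dots> = (\<Sum>b\<in>Basis. (t \<bullet> b) * l b)"
      by (simp add: linear_sum[OF l] linear_cmul[OF l])
    finally show ?thesis by (simp add: c_def inner_sum_right mult.commute)
  qed
  have "linear S"
    unfolding S_def
    by (intro linearI) (auto simp: linear_add[OF linr] linear_cmul[OF linr] scaleR_left_distrib sum.distrib scaleR_sum_right)
  then have "subspace (range S)" by (simp add: linear_subspace_image)
  obtain y z where y: "y \<in> span (range S)" and z: "\<And>w. w \<in> span (range S) \<Longrightarrow> orthogonal z w"
    and yz: "c = y + z" using orthogonal_subspace_decomp_exists[of "range S" c] by metis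
  have "y \<in> range S" using y \<open>subspace (range S)\<close> by (metis span_eq_iff)
  then obtain a where a: "y = S a" by blast
  \<comment> \<open>As \<open>z\<close> is orthogonal to the range of \<open>S\<close>, it is a null
    direction, so \<open>z \<bullet> c = l z = 0\<close>; as also \<open>z \<bullet> y = 0\<close>,
    \<open>z\<close> is orthogonal to itself.\<close>
  have "B z z = z \<bullet> S z" by (simp add: S)
  also have "\<dots> = 0" using z[of "S z"] by (simp add: orthogonal_def span_base)
  finally have "z \<bullet> c = 0" using null c by simp
  moreover have "z \<bullet> y = 0" using z[OF y] by (simp add: orthogonal_def)
  ultimately have "z = 0" using yz by (simp add: inner_add_right)
  then have "B s a = l s" for s using yz a S[of s a] c[of s] by simp
  then show ?thesis using that by blast
qed

lemma (in prob_space) expectation_of_AE_const: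
  fixes h :: "'b \<Rightarrow> real"
  assumes "AE x in M. V x = c" "(\<lambda>x. h (V x)) \<in> borel_measurable M"
  shows "expectation (\<lambda>x. h (V x)) = h c"
proof -
  have "AE x in M. h (V x) = h c" using assms(1) by eventually_elim simp
  then have "expectation (\<lambda>x. h (V x)) = expectation (\<lambda>x. h c)"
    using assms(2) by (intro integral_cong_AE) auto
  then show ?thesis using prob_space by simp
qed

section \<open>Mean and covariance of linear forms\<close>

lemma linear_joint_vec: "linear joint_vec"
  by (intro linearI) (auto simp: joint_vec_def vec_eq_iff split: option.split)

lemma inner_eq_sum_joint_vec: "p \<bullet> z = (\<Sum>j\<in>UNIV. joint_vec p $ j * joint_vec z $ j)"
  for p z :: "(real^'p::finite) \<times> real"
  by (simp add: joint_vec_def inner_prod_def inner_vec_def UNIV_option_conv sum.reindex add.commute)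

text \<open>This and \<open>lin_cov\<close> are built from \<mu> and \<Lambda> instead of integrals,
  so they are literally the same for every law with these moments and allow the comparison of two
  laws.\<close>

definition lin_mean :: "real^('p::finite option) \<Rightarrow> (real^'p) \<times> real \<Rightarrow> real" where
  "lin_mean \<mu> p = (\<Sum>j\<in>UNIV. joint_vec p $ j * \<mu> $ j)"

definition lin_cov :: "real^('p::finite option) \<Rightarrow> real^('p option)^('p option)
    \<Rightarrow> (real^'p) \<times> real \<Rightarrow> (real^'p) \<times> real \<Rightarrow> real" where
  "lin_cov \<mu> \<Lambda> p q = (\<Sum>j\<in>UNIV. \<Sum>k\<in>UNIV. joint_vec p $ j * joint_vec q $ k * \<Lambda> $ j $ k)
     - lin_mean \<mu> p * lin_mean \<mu> q"

lemma linear_lin_mean: "linear (lin_mean \<mu>)"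
  unfolding lin_mean_def
  by (intro linearI) (auto simp: linear_add[OF linear_joint_vec] linear_cmul[OF linear_joint_vec]
      algebra_simps sum.distrib sum_distrib_left)

lemma bilinear_lin_cov: "bilinear (lin_cov \<mu> \<Lambda>)"
proof -
  note lin = linear_add[OF linear_joint_vec] linear_cmul[OF linear_joint_vec]
    linear_add[OF linear_lin_mean] linear_cmul[OF linear_lin_mean]
  show ?thesis unfolding bilinear_def lin_cov_def
    by (intro conjI allI linearI) (auto simp: lin algebra_simps sum.distrib sum_distrib_left)
qed

locale moment_law = prob_space M for M :: "((real^'p::finite) \<times> real) measure" +
  fixes \<mu> :: "real^('p option)" and \<Lambda> :: "real^('p option)^('p option)"
  assumes sets_eq [measurable_cong]: "sets M = sets borel" and moments: "has_moments M \<mu> \<Lambda>"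
begin

abbreviation "mean \<equiv> lin_mean \<mu>"
abbreviation "cov \<equiv> lin_cov \<mu> \<Lambda>"

lemma measurable_inner [measurable]: "(\<lambda>z. p \<bullet> z) \<in> borel_measurable M"
  using sets_eq by (simp cong: measurable_cong_sets)

lemma measurable_fst_M [measurable]: "fst \<in> borel_measurable M"
  by (subst measurable_cong_sets[OF sets_eq refl]) (intro borel_measurable_continuous_onI continuous_intros)

lemma measurable_snd_M [measurable]: "snd \<in> borel_measurable M"
  by (subst measurable_cong_sets[OF sets_eq refl]) (intro borel_measurable_continuous_onI continuous_intros)

lemma integrable_inner: "integrable M (\<lambda>z. p \<bullet> z)"
  and integral_inner: "expectation (\<lambda>z. p \<bullet> z) = mean p"
  using moments by (simp_all add: has_moments_def inner_eq_sum_joint_vec lin_mean_def)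

lemma integrable_inner_mult: "integrable M (\<lambda>z. (p \<bullet> z) * (q \<bullet> z))"
  and integral_inner_mult: "expectation (\<lambda>z. (p \<bullet> z) * (q \<bullet> z)) = cov p q + mean p * mean q"
proof -
  have eq: "(\<lambda>z. (p \<bullet> z) * (q \<bullet> z)) = (\<lambda>z. \<Sum>j\<in>UNIV. \<Sum>k\<in>UNIV.
      (joint_vec p $ j * joint_vec q $ k) * (joint_vec z $ j * joint_vec z $ k))"
    by (simp add: fun_eq_iff inner_eq_sum_joint_vec sum_product ac_simps)
  have int: "integrable M (\<lambda>z. joint_vec z $ j * joint_vec z $ k)"
    and val: "expectation (\<lambda>z. joint_vec z $ j * joint_vec z $ k) = \<Lambda> $ j $ k" for j k
    using moments by (auto simp: has_moments_def)
  show "integrable M (\<lambda>z. (p \<bullet> z) * (q \<bullet> z))" unfolding eq using int by simp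
  show "expectation (\<lambda>z. (p \<bullet> z) * (q \<bullet> z)) = cov p q + mean p * mean q"
    unfolding eq using int val by (simp add: lin_cov_def)
qed

lemma integrable_centered: "integrable M (\<lambda>z. (p \<bullet> z - mean p) * (q \<bullet> z - mean q))"
  and integral_centered: "expectation (\<lambda>z. (p \<bullet> z - mean p) * (q \<bullet> z - mean q)) = cov p q"
proof -
  have eq: "(\<lambda>z. (p \<bullet> z - mean p) * (q \<bullet> z - mean q))
    = (\<lambda>z. (p \<bullet> z) * (q \<bullet> z) - mean q * (p \<bullet> z) - mean p * (q \<bullet> z) + mean p * mean q)"
    by (simp add: fun_eq_iff algebra_simps)
  show "integrable M (\<lambda>z. (p \<bullet> z - mean p) * (q \<bullet> z - mean q))"
    unfolding eq using integrable_inner integrable_inner_mult by simp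
  show "expectation (\<lambda>z. (p \<bullet> z - mean p) * (q \<bullet> z - mean q)) = cov p q"
    unfolding eq using integrable_inner integrable_inner_mult prob_space
    by (simp add: integral_inner integral_inner_mult)
qed

lemma integrable_centered_square: "integrable M (\<lambda>z. (p \<bullet> z - mean p)\<^sup>2)"
  and integral_centered_square: "expectation (\<lambda>z. (p \<bullet> z - mean p)\<^sup>2) = cov p p"
  using integrable_centered[of p p] integral_centered[of p p] by (simp_all add: power2_eq_square)

lemma variance_inner: "variance (\<lambda>z. p \<bullet> z) = cov p p"
  by (simp add: integral_inner integral_centered_square)

lemma cov_sym: "cov p q = cov q p"
  using integral_centered[of p q] integral_centered[of q p] by (simp add: mult.commute)

lemma cov_nonneg: "0 \<le> cov p p"
  by (subst integral_centered_square[symmetric]) simp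

text \<open>Cauchy-Schwarz; supplies the null-direction hypothesis of
  \<open>bilinear_represents_functional\<close>.\<close>

lemma cov_null: "cov p p = 0 \<Longrightarrow> cov p q = 0"
  using integral_mult_Cauchy_Schwarz(2)[OF _ _ integrable_centered_square[of p] integrable_centered_square[of q]]
  by (simp add: integral_centered integral_centered_square)

lemma AE_eq_mean: "cov p p = 0 \<Longrightarrow> AE z in M. p \<bullet> z = mean p"
  using integral_nonneg_eq_0_iff_AE[OF integrable_centered_square[of p]]
  by (simp add: integral_centered_square)

text \<open>The standardized affine functions of \<open>t \<bullet> X\<close> and \<open>Y\<close>
  are admissible, and their correlation depends on the moments alone. This is the lower bound valid
  for every law.\<close>

lemma normalized_correlation_le_hgr:
  assumes t: "cov (t, 0) (t, 0) > 0" and y: "cov (0, 1) (0, 1) > 0"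
  shows "ereal (cov (t, 0) (0, 1) / (sqrt (cov (t, 0) (t, 0)) * sqrt (cov (0, 1) (0, 1)))) \<le> hgr M"
proof -
  let ?f = "\<lambda>x. (t \<bullet> x - mean (t, 0)) / sqrt (cov (t, 0) (t, 0))"
  let ?g = "\<lambda>y. (y - mean (0, 1)) / sqrt (cov (0, 1) (0, 1))"
  have f: "?f (fst z) = ((t, 0) \<bullet> z - mean (t, 0)) / sqrt (cov (t, 0) (t, 0))" for z
    by (simp add: inner_prod_def)
  have g: "?g (snd z) = ((0, 1) \<bullet> z - mean (0, 1)) / sqrt (cov (0, 1) (0, 1))" for z
    by (simp add: inner_prod_def)
  have "ereal (expectation (\<lambda>z. fst (?f, ?g) (fst z) * snd (?f, ?g) (snd z))) \<le> hgr M"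
    unfolding hgr_def
  proof (rule SUP_upper, clarsimp simp only: f g mem_Collect_eq split_conv, intro conjI)
    show "?f \<in> borel_measurable borel" "?g \<in> borel_measurable borel" by measurable
  qed (use t y in \<open>simp_all add: power_divide integrable_inner integrable_centered_square
      integral_inner integral_centered_square prob_space\<close>)
  also have "expectation (\<lambda>z. fst (?f, ?g) (fst z) * snd (?f, ?g) (snd z))
      = cov (t, 0) (0, 1) / (sqrt (cov (t, 0) (t, 0)) * sqrt (cov (0, 1) (0, 1)))"
    unfolding fst_conv snd_conv f g using integral_centered[of "(t, 0)" "(0, 1)"] by simp
  finally show ?thesis .
qed

text \<open>The best linear prediction of \<open>Y\<close> from \<open>X\<close> is \<open>\<kappa> (t \<bullet> X)\<close>, up to a constant; allowing \<open>\<kappa> = 0\<close>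
  lets the direction \<open>t\<close> be nondegenerate even if \<open>X\<close> and \<open>Y\<close> are uncorrelated.\<close>
lemma best_linear_predictor:
  assumes "cov (s, 0) (s, 0) \<noteq> 0"
  obtains t \<kappa> where "\<kappa> \<ge> 0" "cov (t, 0) (t, 0) > 0" "\<And>s. cov (s, 0) (- (\<kappa> *\<^sub>R t), 1) = 0"
proof -
  note cov_add_left = bilinear_ladd[OF bilinear_lin_cov] and cov_add_right = bilinear_radd[OF bilinear_lin_cov]
    and cov_cmul_left = bilinear_lmul[OF bilinear_lin_cov] and cov_cmul_right = bilinear_rmul[OF bilinear_lin_cov]
  have add0: "(x + y, 0) = (x, 0) + (y, 0 :: real)" and cmul0: "(c *\<^sub>R x, 0) = c *\<^sub>R (x, 0 :: real)"
    for x y :: "real^'p" and c by auto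
  have bil: "bilinear (\<lambda>s t. cov (s, 0) (t, 0))"
    unfolding bilinear_def
    by (intro conjI allI linearI; simp only: add0 cmul0 cov_add_left cov_add_right cov_cmul_left cov_cmul_right)
  have lin: "linear (\<lambda>s. cov (s, 0) (0, 1))"
    by (intro linearI; simp only: add0 cmul0 cov_add_left cov_cmul_left)
  \<comment> \<open>The normal equations of linear regression, solvable even for a singular
    covariance of \<open>X\<close>.\<close>
  obtain a where a: "cov (s, 0) (a, 0) = cov (s, 0) (0, 1)" for s
    using bilinear_represents_functional[OF bil lin cov_null] by blast
  show ?thesis
  proof (cases "cov (a, 0) (a, 0) = 0")
    case True
    then have "cov (s, 0) (0, 1) = 0" for s
      using a[of s] cov_null[of "(a, 0)" "(s, 0)"] cov_sym[of "(s, 0)" "(a, 0)"] by simp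
    \<comment> \<open>Here \<open>X\<close> and \<open>Y\<close> are uncorrelated: \<kappa> is 0 and
      the given nondegenerate direction serves as \<open>t\<close>.\<close>
    then show ?thesis using that[of 0 s] assms cov_nonneg[of "(s, 0)"] by simp
  next
    case False
    have "cov (s, 0) (- (1 *\<^sub>R a), 1) = 0" for s
    proof -
      have "(- (1 *\<^sub>R a), 1) = (0, 1) + (- 1) *\<^sub>R (a, 0 :: real)" by simp
      then show ?thesis using a[of s] by (simp only: cov_add_right cov_cmul_right) simp
    qed
    then show ?thesis using that[of 1 a] False cov_nonneg[of "(a, 0)"] by simp
  qed
qed

section \<open>Upper bound for the Gaussian law\<close>

lemma gaussian_char:
  assumes "gaussian_law M"
  shows "expectation (\<lambda>z. iexp (p \<bullet> z)) = iexp (mean p) * complex_of_real (exp (- cov p p / 2))"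
    and "cov p p > 0 \<Longrightarrow> distr M borel (\<lambda>z. (p \<bullet> z - mean p) / sqrt (cov p p)) = std_normal_distribution"
proof -
  have "(\<lambda>z. p \<bullet> z) = (\<lambda>z. fst p \<bullet> fst z + snd p * snd z)"
    by (simp add: fun_eq_iff inner_prod_def)
  then have law: "\<exists>m \<sigma>. \<sigma> \<ge> 0 \<and> distr M lborel (\<lambda>z. p \<bullet> z) =
      (if \<sigma> = 0 then return lborel m else density lborel (normal_density m \<sigma>))"
    using assms unfolding gaussian_law_def by metis
  show "expectation (\<lambda>z. iexp (p \<bullet> z)) = iexp (mean p) * complex_of_real (exp (- cov p p / 2))"
    and "cov p p > 0 \<Longrightarrow> distr M borel (\<lambda>z. (p \<bullet> z - mean p) / sqrt (cov p p)) = std_normal_distribution"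
    using normal_law_char[OF measurable_inner law] unfolding variance_inner unfolding integral_inner by auto
qed

text \<open>Without cross covariance, the quadratic form in the exponent of the Gaussian
  characteristic function splits into a sum. The scale \<open>c\<close> and shift \<open>m\<close>
  let the standardized residual be covered directly.\<close>

lemma gaussian_residual_independent:
  assumes G: "gaussian_law M" and uncor: "\<And>s. cov (s, 0) q = 0"
  shows "distr M (borel \<Otimes>\<^sub>M borel) (\<lambda>z. (fst z, c * (q \<bullet> z - m)))
    = distr M borel fst \<Otimes>\<^sub>M distr M borel (\<lambda>z. c * (q \<bullet> z - m))"
proof (rule distr_pair_eq_pair_measure_of_char)
  fix u \<tau>
  have split: "expectation (\<lambda>z. iexp (p \<bullet> z + \<tau> * (c * (q \<bullet> z - m))))
      = iexp (- (\<tau> * c * m)) * (iexp (mean (p + (\<tau> * c) *\<^sub>R q)) * complex_of_real (exp (- cov (p + (\<tau> * c) *\<^sub>R q) (p + (\<tau> * c) *\<^sub>R q) / 2)))" for p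
  proof -
    have "p \<bullet> z + \<tau> * (c * (q \<bullet> z - m)) = - (\<tau> * c * m) + (p + (\<tau> * c) *\<^sub>R q) \<bullet> z" for z
      by (simp add: inner_add_left algebra_simps)
    then have "iexp (p \<bullet> z + \<tau> * (c * (q \<bullet> z - m))) = iexp (- (\<tau> * c * m)) * iexp ((p + (\<tau> * c) *\<^sub>R q) \<bullet> z)" for z
      by (simp only: of_real_add distrib_left exp_add)
    then show ?thesis by (simp only: integral_mult_right_zero gaussian_char(1)[OF G])
  qed
  \<comment> \<open>The summand \<open>0\<close> is kept so that the terms match
    \<open>split\<close> at \<open>p = 0\<close>.\<close>
  have cov_eq: "cov ((u, 0) + (\<tau> * c) *\<^sub>R q) ((u, 0) + (\<tau> * c) *\<^sub>R q)
      = cov (u, 0) (u, 0) + cov (0 + (\<tau> * c) *\<^sub>R q) (0 + (\<tau> * c) *\<^sub>R q)"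
    using uncor[of u] cov_sym[of q "(u, 0)"]
    by (simp add: bilinear_ladd[OF bilinear_lin_cov] bilinear_radd[OF bilinear_lin_cov]
        bilinear_lmul[OF bilinear_lin_cov] bilinear_rmul[OF bilinear_lin_cov] del: scaleR_Pair)
  have mean_eq: "mean ((u, 0) + (\<tau> * c) *\<^sub>R q) = mean (u, 0) + mean (0 + (\<tau> * c) *\<^sub>R q)"
    by (simp add: linear_add[OF linear_lin_mean])
  have "expectation (\<lambda>z. iexp (u \<bullet> fst z + \<tau> * (c * (q \<bullet> z - m))))
      = expectation (\<lambda>z. iexp ((u, 0) \<bullet> z + \<tau> * (c * (q \<bullet> z - m))))"
    by (simp add: inner_prod_def)
  also have "\<dots> = (iexp (mean (u, 0)) * complex_of_real (exp (- cov (u, 0) (u, 0) / 2)))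
      * (iexp (- (\<tau> * c * m)) * (iexp (mean (0 + (\<tau> * c) *\<^sub>R q)) * complex_of_real (exp (- cov (0 + (\<tau> * c) *\<^sub>R q) (0 + (\<tau> * c) *\<^sub>R q) / 2))))"
    unfolding split cov_eq mean_eq
    by (simp only: of_real_add distrib_left exp_add minus_add_distrib add_divide_distrib of_real_mult ac_simps)
  also have "\<dots> = expectation (\<lambda>z. iexp ((u, 0) \<bullet> z)) * expectation (\<lambda>z. iexp (0 \<bullet> z + \<tau> * (c * (q \<bullet> z - m))))"
    by (simp only: split gaussian_char(1)[OF G])
  finally show "expectation (\<lambda>z. iexp (u \<bullet> fst z + \<tau> * (c * (q \<bullet> z - m))))
      = expectation (\<lambda>z. iexp (u \<bullet> fst z)) * expectation (\<lambda>z. iexp (\<tau> * (c * (q \<bullet> z - m))))"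
    by (simp add: inner_prod_def)
qed measurable

lemma gaussian_correlation_le:
  fixes f :: "real^'p \<Rightarrow> real" and g :: "real \<Rightarrow> real"
  assumes G: "gaussian_law M" and \<kappa>: "\<kappa> \<ge> 0" and t: "cov (t, 0) (t, 0) > 0"
    and uncor: "\<And>s. cov (s, 0) (- (\<kappa> *\<^sub>R t), 1) = 0" and y: "cov (0, 1) (0, 1) > 0"
    and f[measurable]: "f \<in> borel_measurable borel" and f1: "integrable M (\<lambda>z. f (fst z))"
    and f2: "integrable M (\<lambda>z. (f (fst z))\<^sup>2)" and f0: "expectation (\<lambda>z. f (fst z)) = 0"
    and g[measurable]: "g \<in> borel_measurable borel" and g2: "integrable M (\<lambda>z. (g (snd z))\<^sup>2)"
  shows "expectation (\<lambda>z. f (fst z) * g (snd z))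
    \<le> cov (t, 0) (0, 1) / (sqrt (cov (t, 0) (t, 0)) * sqrt (cov (0, 1) (0, 1)))
      * sqrt (expectation (\<lambda>z. (f (fst z))\<^sup>2)) * sqrt (expectation (\<lambda>z. (g (snd z))\<^sup>2))"
proof -
  define q where "q = (- (\<kappa> *\<^sub>R t), 1 :: real)"
  define vt where "vt = cov (t, 0) (t, 0)"
  define vy where "vy = cov (0, 1) (0, 1)"
  have vt: "vt > 0" and vy: "vy > 0" using t y by (simp_all add: vt_def vy_def)
  note lin = bilinear_ladd[OF bilinear_lin_cov] bilinear_radd[OF bilinear_lin_cov]
        bilinear_lmul[OF bilinear_lin_cov] bilinear_rmul[OF bilinear_lin_cov]
  \<comment> \<open>Regression decomposition: \<open>q\<close> is the direction of the residual
    \<open>W\<close>.\<close>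
  have y_eq: "(0, 1) = \<kappa> *\<^sub>R (t, 0) + q" by (simp add: q_def)
  have uncor': "cov (s, 0) q = 0" for s using uncor[of s] by (simp add: q_def)
  have cov_ty: "cov (t, 0) (0, 1) = \<kappa> * vt"
    using uncor'[of t] by (simp only: y_eq lin) (simp add: vt_def)
  have vy_eq: "vy = \<kappa>\<^sup>2 * vt + cov q q"
    unfolding vy_def using uncor'[of t] cov_sym[of q "(t, 0)"]
    by (simp only: y_eq lin) (simp add: vt_def power2_eq_square)
  define R where "R = \<kappa> * sqrt vt / sqrt vy"
  have R: "R \<ge> 0" using \<kappa> vt vy by (simp add: R_def)
  have R_eq: "cov (t, 0) (0, 1) / (sqrt (cov (t, 0) (t, 0)) * sqrt (cov (0, 1) (0, 1))) = R"
  proof -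
    have "cov (t, 0) (0, 1) = \<kappa> * sqrt vt * sqrt vt" using vt by (simp add: cov_ty)
    then show ?thesis using vt by (simp add: R_def flip: vt_def vy_def)
  qed
  have R2: "R\<^sup>2 = \<kappa>\<^sup>2 * vt / vy" using vt vy by (simp add: R_def power_divide power_mult_distrib)
  have fg_le: "expectation (\<lambda>z. f (fst z) * g (snd z))
    \<le> R * sqrt (expectation (\<lambda>z. (f (fst z))\<^sup>2)) * sqrt (expectation (\<lambda>z. (g (snd z))\<^sup>2))"
  proof (cases "R < 1")
    \<comment> \<open>By \<open>vy_eq\<close> the value of \<open>R\<close> is at most 1, so here it
      equals 1 and plain Cauchy-Schwarz is enough.\<close>
    case False
    let ?c = "sqrt (expectation (\<lambda>z. (f (fst z))\<^sup>2)) * sqrt (expectation (\<lambda>z. (g (snd z))\<^sup>2))"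
    have "(expectation (\<lambda>z. f (fst z) * g (snd z)))\<^sup>2 \<le> ?c\<^sup>2"
      using integral_mult_Cauchy_Schwarz(2)[OF _ _ f2 g2] by (simp add: power_mult_distrib)
    then have "expectation (\<lambda>z. f (fst z) * g (snd z)) \<le> ?c" by (rule power2_le_imp_le) simp
    also have "\<dots> \<le> R * ?c" using mult_right_mono[of 1 R ?c] False by simp
    finally show ?thesis by (simp add: mult.assoc)
  next
    case True
    define vw where "vw = cov q q"
    have "R\<^sup>2 < 1" using True R by (simp add: power_less_one_iff abs_square_less_1)
    then have vw: "vw > 0" using vy by (simp add: R2 vw_def vy_eq)
    have r: "sqrt (1 - R\<^sup>2) = sqrt vw / sqrt vy"
      using vy by (simp add: R2 vw_def real_sqrt_divide[symmetric] vy_eq field_simps)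
    let ?u = "\<lambda>x. (t \<bullet> x - mean (t, 0)) / sqrt vt"
    let ?Z = "\<lambda>z. (1 / sqrt vw) * (q \<bullet> z - mean q)"
    let ?Y = "\<lambda>z. (snd z - mean (0, 1)) / sqrt vy"
    \<comment> \<open>Undoes the standardization of \<open>Y\<close>.\<close>
    let ?g = "\<lambda>v. g (mean (0, 1) + sqrt vy * v)"
    have gY: "?g (?Y z) = g (snd z)" for z using vy by simp
    have law_Z: "distr M borel ?Z = std_normal_distribution"
      using gaussian_char(2)[OF G, of q] vw by (simp add: vw_def)
    have "expectation (\<lambda>z. f (fst z) * ?g (?Y z))
      \<le> R * sqrt (expectation (\<lambda>z. (f (fst z))\<^sup>2)) * sqrt (expectation (\<lambda>z. (?g (?Y z))\<^sup>2))"
    proof (rule std_normal_pair_correlation_le[where X = fst and u = ?u and Z = ?Z and Y = ?Y and f = f and g = ?g and N = borel])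
      show "distr M (borel \<Otimes>\<^sub>M borel) (\<lambda>z. (fst z, ?Z z)) = distr M borel fst \<Otimes>\<^sub>M std_normal_distribution"
        using gaussian_residual_independent[OF G uncor', of "1 / sqrt vw" "mean q"] law_Z by simp
      show "distr M borel (\<lambda>z. ?u (fst z)) = std_normal_distribution"
        using gaussian_char(2)[OF G, of "(t, 0)"] vt by (simp add: vt_def inner_prod_def)
      show "distr M borel ?Y = std_normal_distribution"
        using gaussian_char(2)[OF G, of "(0, 1)"] vy by (simp add: vy_def inner_prod_def)
      show "?Y z = R * ?u (fst z) + sqrt (1 - R\<^sup>2) * ?Z z" for z
      proof -
        have "?Y z = ((0, 1) \<bullet> z - mean (0, 1)) / sqrt vy" by (simp add: inner_prod_def)
        also have "\<dots> = (\<kappa> * ((t, 0) \<bullet> z - mean (t, 0)) + (q \<bullet> z - mean q)) / sqrt vy"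
          by (simp only: y_eq linear_add[OF linear_lin_mean] linear_cmul[OF linear_lin_mean] inner_add_left inner_scaleR_left)
            (simp add: algebra_simps)
        also have "\<dots> = R * ?u (fst z) + sqrt (1 - R\<^sup>2) * ?Z z"
          unfolding r using vt vy vw by (simp add: R_def inner_prod_def add_divide_distrib)
        finally show ?thesis .
      qed
    qed (use True R f1 f2 f0 g2 gY in auto)
    then show ?thesis by (simp only: gY)
  qed
  then show ?thesis by (simp only: R_eq)
qed

end

theorem theorem1:
  fixes \<mu> :: "real^(('p::finite) option)" and \<Lambda> :: "real^('p option)^('p option)"
    and PG :: "((real^'p) \<times> real) measure"
  assumes "gaussian_law PG" and "has_moments PG \<mu> \<Lambda>"
  shows "\<forall>P. is_law P \<and> has_moments P \<mu> \<Lambda> \<longrightarrow> hgr PG \<le> hgr P"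
proof (intro allI impI)
  fix P :: "((real^'p) \<times> real) measure"
  assume P: "is_law P \<and> has_moments P \<mu> \<Lambda>"
  interpret P: moment_law P \<mu> \<Lambda>
    using P by (simp add: is_law_def moment_law_def moment_law_axioms_def)
  interpret G: moment_law PG \<mu> \<Lambda>
    using assms by (simp add: gaussian_law_def is_law_def moment_law_def moment_law_axioms_def)
  show "hgr PG \<le> hgr P"
    unfolding hgr_def[of PG]
  proof (rule SUP_least, clarify)
    fix f :: "real^'p \<Rightarrow> real" and g :: "real \<Rightarrow> real"
    assume [measurable]: "f \<in> borel_measurable borel" "g \<in> borel_measurable borel"
      and f1: "integrable PG (\<lambda>z. f (fst z))" and "integrable PG (\<lambda>z. g (snd z))"
      and f2: "integrable PG (\<lambda>z. (f (fst z))\<^sup>2)" and g2: "integrable PG (\<lambda>z. (g (snd z))\<^sup>2)"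
      and Ef: "(\<integral>z. f (fst z) \<partial>PG) = 0" and Eg: "(\<integral>z. g (snd z) \<partial>PG) = 0"
      and Ef2: "(\<integral>z. (f (fst z))\<^sup>2 \<partial>PG) = 1" and Eg2: "(\<integral>z. (g (snd z))\<^sup>2 \<partial>PG) = 1"
    \<comment> \<open>If \<open>Y\<close> were almost surely constant, mean 0 would make
      \<open>g\<close> vanish at that constant, against second moment 1. The same reasoning for
      \<open>X\<close> and \<open>f\<close> gives the nondegenerate direction below.\<close>
    have y: "G.cov (0, 1) (0, 1) > 0"
    proof (rule ccontr)
      assume "\<not> ?thesis"
      then have "AE z in PG. (0, 1) \<bullet> z = G.mean (0, 1)"
        using G.AE_eq_mean[of "(0, 1)"] G.cov_nonneg[of "(0, 1)"] by simp
      then have c: "AE z in PG. snd z = G.mean (0, 1)" by (simp add: inner_prod_def)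
      show False
        using G.expectation_of_AE_const[OF c, of g] G.expectation_of_AE_const[OF c, of "\<lambda>y. (g y)\<^sup>2"] Eg Eg2 by simp
    qed
    have "\<exists>s. G.cov (s, 0) (s, 0) \<noteq> 0"
    proof (rule ccontr)
      assume "\<not> ?thesis"
      then have "AE z in PG. (axis i 1, 0) \<bullet> z = G.mean (axis i 1, 0)" for i :: 'p
        by (intro G.AE_eq_mean) simp
      then have "AE z in PG. \<forall>i. fst z $ i = G.mean (axis i 1, 0)"
        by (simp add: AE_all_countable inner_prod_def inner_axis')
      then have c: "AE z in PG. fst z = (\<chi> i. G.mean (axis i 1, 0))"
        by eventually_elim (simp add: vec_eq_iff)
      show False
        using G.expectation_of_AE_const[OF c, of f] G.expectation_of_AE_const[OF c, of "\<lambda>y. (f y)\<^sup>2"] Ef Ef2 by simp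
    qed
    then obtain t \<kappa> where t: "\<kappa> \<ge> 0" "G.cov (t, 0) (t, 0) > 0" "\<And>s. G.cov (s, 0) (- (\<kappa> *\<^sub>R t), 1) = 0"
      using G.best_linear_predictor by metis
    have "(\<integral>z. f (fst z) * g (snd z) \<partial>PG)
        \<le> G.cov (t, 0) (0, 1) / (sqrt (G.cov (t, 0) (t, 0)) * sqrt (G.cov (0, 1) (0, 1)))"
      using G.gaussian_correlation_le[OF assms(1) t y _ f1 f2 Ef _ g2] by (simp add: Ef2 Eg2)
    \<comment> \<open>The bound obtained under \<open>PG\<close> involves the moments only, so it is
      also the correlation of affine functions under \<open>P\<close>.\<close>
    also have "ereal \<dots> \<le> hgr P"
      by (rule P.normalized_correlation_le_hgr[OF t(2) y])
    finally show "ereal (\<integral>z. fst (f, g) (fst z) * snd (f, g) (snd z) \<partial>PG) \<le> hgr P" by simp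
  qed
qed

end
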